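(* Let $x\in\mathbb{R}^N$, $\eta_x>0$, and let $\phi:\mathbb{R}^N\to\mathbb{R}$ satisfy hypothesis (H) at $x$ with radius $\eta_x$. Then for every $\epsilon\in(0,\eta_x)$: $$\Big|\mathcal{A}_\epsilon^o\phi(x)-\phi(x)-\frac{1}{c_s(1-s)}\epsilon^{2s}\mathcal{L}_s[\phi](x)\Big|\le \frac{s}{1-s}C_x\epsilon^2+E_\epsilon,$$ where $E_\epsilon=0$ if $p_x=0$, and if $p_x\neq0$, $$E_\epsilon=\epsilon^{2s}\Big(4sC_x\frac{\eta_x^{2-2s}-\epsilon^{2-2s}}{1-s}A_\epsilon+\Big(\eta_x^{-2s}+\frac{2s}{2s-1}\eta_x^{1-2s}\Big)\omega_\phi(A_\epsilon)\Big).$$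
   Context: Fix $N\ge1$ and $s\in(\frac12,1)$. Let $C_s=\frac{4^s s\,\Gamma(\frac12+s)}{\pi^{1/2}\Gamma(1-s)}$ and $c_s=\frac{C_s}{s(1-s)}$. Let $\mu_s$ be the Borel measure on $(0,\infty)$ with $\mathrm{d}\mu_s(t)=C_s t^{-1-2s}\,\mathrm{d}t$ (so $\mu_s((\epsilon,\infty))=\frac{C_s}{2s\epsilon^{2s}}$), and write $\fint_\epsilon^\infty g\,\mathrm{d}\mu_s=\frac{1}{\mu_s((\epsilon,\infty))}\int_\epsilon^\infty g\,\mathrm{d}\mu_s$. For $\phi:\mathbb{R}^N\to\mathbb{R}$ and $x,y,\tilde y\in\mathbb{R}^N$ let $L_\phi(x,y,\tilde y)=\phi(x+y)+\phi(x-\tilde y)-2\phi(x)$. Define $$\mathcal{L}_s[\phi](x)=\sup_{|y|=1}\inf_{|\tilde y|=1}\int_0^\infty L_\phi(x,ty,t\tilde y)\,\mathrm{d}\mu_s(t),$$ where $\int_0^\infty$ means $\lim_{\delta\to0^+}\int_\delta^\infty$ (a value in $[-\infty,\infty]$); under the hypotheses this is a finite real number. Define the average $$\mathcal{A}_\epsilon^o\phi(x)=\frac12\Big(\sup_{|y|=1}\fint_\epsilon^\infty\phi(x+ty)\,\mathrm{d}\mu_s(t)+\inf_{|y|=1}\fint_\epsilon^\infty\phi(x+ty)\,\mathrm{d}\mu_s(t)\Big).$$ Hypothesis (H) at $x$ with radius $\eta_x>0$: $\phi:\mathbb{R}^N\to\mathbb{R}$ is bounded and Borel; (i) $\phi\in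 C^2(\bar B_{\eta_x}(x))$, and we set $p_x=\nabla\phi(x)$, $C_x=\frac12\|\nabla^2\phi\|_{L^\infty(B_{\eta_x}(x))}$; (ii) $\phi$ is bounded and uniformly continuous on $\mathbb{R}^N\setminus\bar B_{\eta_x}(x)$, with modulus $\omega_\phi(a)=\sup\{|\phi(z)-\phi(w)|: z,w\in\mathbb{R}^N\setminus\bar B_{\eta_x}(x),\ |z-w|\le a\}$. When $p_x\ne0$ and $0<\epsilon<\eta_x$ define $$\kappa_\epsilon=\sup\Big\{a\in[0,2]:\ a^2\le\frac{8\omega_\phi(a)}{|p_x|}\cdot\frac{\frac{2s-1}{2s}\eta_x^{-2s}+\eta_x^{1-2s}}{\epsilon^{1-2s}-\eta_x^{1-2s}}\Big\},\quad A_\epsilon=\max\Big\{\frac{16C_x}{|p_x|}\cdot\frac{2s-1}{1-s}\cdot\frac{\eta_x^{2-2s}-\epsilon^{2-2s}}{\epsilon^{1-2s}-\eta_x^{1-2s}},\ \kappa_\epsilon\Big\}.$$ *)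

theory Defs
  imports "HOL-Analysis.Analysis"
begin

definition C_s :: "real \<Rightarrow> real" where
  "C_s s = (4 powr s * s * Gamma (1/2 + s)) / (sqrt pi * Gamma (1 - s))"

definition c_s :: "real \<Rightarrow> real" where
  "c_s s = C_s s / (s * (1 - s))"

definition mu_s :: "real \<Rightarrow> real measure" where
  "mu_s s = density lborel (\<lambda>t. ennreal (indicator {0<..} t * (C_s s * t powr (-1 - 2* s))))"

definition favg :: "real \<Rightarrow> real \<Rightarrow> (real \<Rightarrow> real) \<Rightarrow> real" where
  "favg s \<epsilon> g = (LINT t:{\<epsilon><..}|mu_s s. g t) / measure (mu_s s) {\<epsilon><..}"

definition Lphi :: "('a::euclidean_space \<Rightarrow> real) \<Rightarrow> 'a \<Rightarrow> 'a \<Rightarrow> 'a \<Rightarrow> real" where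
  "Lphi \<phi> x y y' = \<phi> (x + y) + \<phi> (x - y') - 2 * \<phi> x"

text \<open>Improper integral int_0^infinity L dmu_s as lim_{delta -> 0+} int_delta^infinity, a value in [-inf,inf].\<close>
definition int0 :: "real \<Rightarrow> ('a::euclidean_space \<Rightarrow> real) \<Rightarrow> 'a \<Rightarrow> 'a \<Rightarrow> 'a \<Rightarrow> ereal" where
  "int0 s \<phi> x y y' =
     Lim (at_right 0) (\<lambda>\<delta>. ereal (LINT t:{\<delta><..}|mu_s s. Lphi \<phi> x (t *\<^sub>R y) (t *\<^sub>R y')))"

text \<open>The operator L_s[phi](x) (a finite real number under the hypotheses).\<close>
definition Ls :: "real \<Rightarrow> ('a::euclidean_space \<Rightarrow> real) \<Rightarrow> 'a \<Rightarrow> real" where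
  "Ls s \<phi> x = real_of_ereal
     (SUP y\<in>sphere 0 1. INF y'\<in>sphere 0 1. int0 s \<phi> x y y')"

definition Ao :: "real \<Rightarrow> real \<Rightarrow> ('a::euclidean_space \<Rightarrow> real) \<Rightarrow> 'a \<Rightarrow> real" where
  "Ao s \<epsilon> \<phi> x = (1/2) *
     ((SUP y\<in>sphere 0 1. favg s \<epsilon> (\<lambda>t. \<phi> (x + t *\<^sub>R y)))
      + (INF y\<in>sphere 0 1. favg s \<epsilon> (\<lambda>t. \<phi> (x + t *\<^sub>R y))))"

definition omega_phi :: "('a::euclidean_space \<Rightarrow> real) \<Rightarrow> 'a \<Rightarrow> real \<Rightarrow> real \<Rightarrow> real" where
  "omega_phi \<phi> x \<eta> a = Sup {\<bar>\<phi> z - \<phi> w\<bar> | z w. z \<notin> cball x \<eta> \<and> w \<notin> cball x \<eta> \<and> dist z w \<le> a}"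

definition kappa :: "real \<Rightarrow> ('a::euclidean_space \<Rightarrow> real) \<Rightarrow> 'a \<Rightarrow> real \<Rightarrow> real \<Rightarrow> real \<Rightarrow> real" where
  "kappa s \<phi> x \<eta> p \<epsilon> = Sup {a \<in> {0..2}. a\<^sup>2 \<le> 8 * omega_phi \<phi> x \<eta> a / p *
      (((2* s - 1) / (2* s)) * \<eta> powr (-2* s) + \<eta> powr (1 - 2* s)) / (\<epsilon> powr (1 - 2* s) - \<eta> powr (1 - 2* s))}"

text \<open>A_eps; here p stands for |p_x| and Cx for C_x.\<close>
definition A_eps :: "real \<Rightarrow> ('a::euclidean_space \<Rightarrow> real) \<Rightarrow> 'a \<Rightarrow> real \<Rightarrow> real \<Rightarrow> real \<Rightarrow> real \<Rightarrow> real" where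
  "A_eps s \<phi> x \<eta> p Cx \<epsilon> = max
     (16 * Cx / p * ((2* s - 1) / (1 - s)) * (\<eta> powr (2 - 2* s) - \<epsilon> powr (2 - 2* s)) / (\<epsilon> powr (1 - 2* s) - \<eta> powr (1 - 2* s)))
     (kappa s \<phi> x \<eta> p \<epsilon>)"

definition E_eps :: "real \<Rightarrow> ('a::euclidean_space \<Rightarrow> real) \<Rightarrow> 'a \<Rightarrow> real \<Rightarrow> 'a \<Rightarrow> real \<Rightarrow> real \<Rightarrow> real" where
  "E_eps s \<phi> x \<eta> p Cx \<epsilon> =
     (if p = 0 then 0 else
       \<epsilon> powr (2* s) * (4 * s * Cx * (\<eta> powr (2 - 2* s) - \<epsilon> powr (2 - 2* s)) / (1 - s) * A_eps s \<phi> x \<eta> (norm p) Cx \<epsilon>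
         + (\<eta> powr (-2* s) + (2* s) / (2* s - 1) * \<eta> powr (1 - 2* s)) * omega_phi \<phi> x \<eta> (A_eps s \<phi> x \<eta> (norm p) Cx \<epsilon>)))"

end

theory Submission
  imports Defs
begin

text \<open>
  Write \<open>G a y\<close> for the integral of \<open>\<phi> (x + t y) - \<phi> x\<close> over \<open>t > a\<close> against \<open>t powr (-1 - 2 s)\<close>.
  Up to constants, \<open>Ao - \<phi> x\<close> is \<open>sup G \<epsilon> + inf G \<epsilon>\<close>, and the integral in \<open>Ls\<close> is the limit of
  \<open>G \<delta> y + G \<delta> (- y')\<close>. By Taylor expansion the part over \<open>t \<le> \<epsilon>\<close> is at most
  \<open>C_x \<epsilon> powr (2 - 2 s) / (1 - s)\<close> plus the first-order term \<open>p \<bullet> (y - y')\<close> times a divergent integral.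
  If \<open>p = 0\<close> this compares the two sup-inf expressions directly. If \<open>p \<noteq> 0\<close> the divergence forces
  \<open>y = y' = u := p / |p|\<close>, so that \<open>Ls\<close> is the symmetric integral in direction \<open>u\<close>, and it remains to see
  that \<open>G \<epsilon>\<close> is nearly maximal at \<open>u\<close> and nearly minimal at \<open>- u\<close>. The supremum error is nonnegative
  and the infimum error nonpositive, so they do not add up; this saves the factor 2 that is lost when
  \<open>\<omega>\<close> is iterated around the ball. In dimension one that iteration is impossible, but there the
  sphere is \<open>{u, - u}\<close> and both errors cancel exactly.
\<close>

section \<open>Integrals of powers and limits of truncated integrals\<close>

lemma set_integrable_lborel_powr_tail:
  fixes a e :: real
  assumes "e < -1" "a > 0"
  shows "set_integrable lborel {a<..} (\<lambda>t. t powr e)"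
    and "(LINT t:{a<..}|lborel. t powr e) = - (a powr (e + 1)) / (e + 1)"
proof -
  have I: "((\<lambda>t. t powr e) has_integral - (a powr (e + 1)) / (e + 1)) {a..}"
    by (rule has_integral_powr_to_inf[OF assms])
  have I': "((\<lambda>t. t powr e) has_integral - (a powr (e + 1)) / (e + 1)) {a<..}"
    by (rule iffD1[OF has_integral_spike_set_eq I]; rule negligible_subset[of "{a}"]) auto
  \<comment> \<open>A nonnegative gauge-integrable function is absolutely integrable, and Borel
    measurability takes it from the completed measure back to \<open>lborel\<close>.\<close>
  then have "(\<lambda>t. t powr e) absolutely_integrable_on {a<..}"
    by (intro nonnegative_absolutely_integrable_1) auto
  then show 1: "set_integrable lborel {a<..} (\<lambda>t. t powr e)"
    unfolding set_integrable_def by (simp add: integrable_completion)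
  show "(LINT t:{a<..}|lborel. t powr e) = - (a powr (e + 1)) / (e + 1)"
    using set_borel_integral_eq_integral(2)[OF 1] I' by (simp add: integral_unique)
qed

lemma set_integrable_lborel_powr_head:
  fixes c e :: real
  assumes "e > -1" "c > 0"
  shows "set_integrable lborel {0<..c} (\<lambda>t. t powr e)"
    and "(LINT t:{0<..c}|lborel. t powr e) = c powr (e + 1) / (e + 1)"
proof -
  have I: "((\<lambda>t. t powr e) has_integral c powr (e + 1) / (e + 1)) {0..c}"
    using assms by (intro has_integral_powr_from_0) auto
  have I': "((\<lambda>t. t powr e) has_integral c powr (e + 1) / (e + 1)) {0<..c}"
    by (rule iffD1[OF has_integral_spike_set_eq I]; rule negligible_subset[of "{0}"]) auto
  then have "(\<lambda>t. t powr e) absolutely_integrable_on {0<..c}"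
    by (intro nonnegative_absolutely_integrable_1) auto
  then show 1: "set_integrable lborel {0<..c} (\<lambda>t. t powr e)"
    unfolding set_integrable_def by (simp add: integrable_completion)
  show "(LINT t:{0<..c}|lborel. t powr e) = c powr (e + 1) / (e + 1)"
    using set_borel_integral_eq_integral(2)[OF 1] I' by (simp add: integral_unique)
qed

text \<open>The interval is a difference of two tails when \<open>e < -1\<close> and of two heads
  when \<open>e > -1\<close>. The logarithmic exponent -1 is left out; the exponents met below are
  -2 s and 1 - 2 s.\<close>

lemma set_integral_lborel_powr_Ioc:
  fixes a b e :: real
  assumes e: "e < -1 \<or> e > -1" and "0 < a" "a \<le> b"
  shows "set_integrable lborel {a<..b} (\<lambda>t. t powr e)"
    and "(LINT t:{a<..b}|lborel. t powr e) = (b powr (e + 1) - a powr (e + 1)) / (e + 1)"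
proof -
  consider "e < -1" | "e > -1" using e by blast
  then have "set_integrable lborel {a<..b} (\<lambda>t. t powr e) \<and>
    (LINT t:{a<..b}|lborel. t powr e) = (b powr (e + 1) - a powr (e + 1)) / (e + 1)"
  proof cases
    case 1
    have i: "set_integrable lborel {a<..b} (\<lambda>t. t powr e)"
      by (rule set_integrable_subset[OF set_integrable_lborel_powr_tail(1)[OF 1 \<open>0 < a\<close>]]) auto
    have "{a<..} = {a<..b} \<union> {b<..}" using assms by auto
    then have "(LINT t:{a<..}|lborel. t powr e) =
        (LINT t:{a<..b}|lborel. t powr e) + (LINT t:{b<..}|lborel. t powr e)"
      using 1 assms i
      by (simp add: set_integral_Un set_integrable_lborel_powr_tail(1) disjoint_iff)
    then show ?thesis
      using i 1 assms by (simp add: set_integrable_lborel_powr_tail(2) diff_divide_distrib)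
  next
    case 2
    have b: "b > 0" using assms by simp
    have i: "set_integrable lborel {a<..b} (\<lambda>t. t powr e)"
      by (rule set_integrable_subset[OF set_integrable_lborel_powr_head(1)[OF 2 b]]) (use assms in auto)
    have "{0<..b} = {0<..a} \<union> {a<..b}" using assms by auto
    then have "(LINT t:{0<..b}|lborel. t powr e) =
        (LINT t:{0<..a}|lborel. t powr e) + (LINT t:{a<..b}|lborel. t powr e)"
      using 2 assms i
      by (simp add: set_integral_Un set_integrable_lborel_powr_head(1) disjoint_iff)
    then show ?thesis
      using i 2 b assms by (simp add: set_integrable_lborel_powr_head(2) diff_divide_distrib)
  qed
  then show "set_integrable lborel {a<..b} (\<lambda>t. t powr e)"
    and "(LINT t:{a<..b}|lborel. t powr e) = (b powr (e + 1) - a powr (e + 1)) / (e + 1)"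
    by auto
qed

text \<open>Serves to evaluate the improper integral: truncations of a Taylor remainder that is
  integrable up to 0 converge to its full integral.\<close>

lemma tendsto_set_integral_Ioc_at_right:
  fixes a b :: real and f :: "real \<Rightarrow> real"
  assumes "a < b" "set_integrable lborel {a<..b} f"
  shows "((\<lambda>\<delta>. LINT t:{\<delta><..b}|lborel. f t) \<longlongrightarrow> (LINT t:{a<..b}|lborel. f t)) (at_right a)"
proof -
  have "(LINT t:{\<delta><..b}|lborel. f t) = (LINT t:{\<delta>..b}|lborel. f t)" for \<delta>
    by (rule set_integral_discrete_difference[of "{\<delta>}"]) auto
  then show ?thesis
    using tendsto_set_lebesgue_integral_at_right[OF assms(1) _ assms(2)] by simp
qed

lemma abs_set_integral_le:
  fixes f h :: "'b \<Rightarrow> real"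
  assumes "set_integrable M A f" "set_integrable M A h"
    and "\<And>t. t \<in> A \<Longrightarrow> \<bar>f t\<bar> \<le> h t"
  shows "\<bar>LINT t:A|M. f t\<bar> \<le> (LINT t:A|M. h t)"
proof -
  have "(LINT t:A|M. f t) \<le> (LINT t:A|M. h t)"
    by (rule set_integral_mono[OF assms(1,2)]) (use assms(3) abs_le_D1 in blast)
  moreover have "(LINT t:A|M. - f t) \<le> (LINT t:A|M. h t)"
    using assms(1) by (intro set_integral_mono[OF _ assms(2)])
      (use assms(3) abs_le_D2 in \<open>auto simp: set_integrable_def\<close>)
  ultimately show ?thesis using assms(1) by (simp add: set_integral_uminus)
qed

section \<open>First-order estimates near the centre of the ball\<close>

text \<open>Along the segment from x to x + h the slope differs from \<open>g x \<bullet> h\<close>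
  by at most B r |h|^2, and integrating r over [0, 1] yields the factor 1/2.\<close>

lemma gradient_Taylor_bound:
  fixes \<phi> :: "'a::euclidean_space \<Rightarrow> real" and g :: "'a \<Rightarrow> 'a"
  assumes grad: "\<And>z. z \<in> cball x \<eta> \<Longrightarrow> (\<phi> has_derivative (\<lambda>h. g z \<bullet> h)) (at z within cball x \<eta>)"
    and lip: "\<And>z. z \<in> cball x \<eta> \<Longrightarrow> norm (g z - g x) \<le> B * norm (z - x)"
    and h: "norm h \<le> \<eta>"
  shows "\<bar>\<phi> (x + h) - \<phi> x - g x \<bullet> h\<bar> \<le> B / 2 * (norm h)\<^sup>2"
proof -
  have incb: "x + r *\<^sub>R h \<in> cball x \<eta>" if "0 \<le> r" "r \<le> 1" for r :: real
    using that h by (simp add: dist_norm mult_left_le_one_le order_trans[of "r * norm h" "norm h"])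
  have D: "((\<lambda>r. \<phi> (x + r *\<^sub>R h)) has_derivative (\<lambda>u. g (x + r *\<^sub>R h) \<bullet> (u *\<^sub>R h))) (at r within {0..1})"
    if "0 \<le> r" "r \<le> 1" for r
  proof -
    have "(\<phi> has_derivative (\<lambda>h'. g (x + r *\<^sub>R h) \<bullet> h')) (at (x + r *\<^sub>R h) within (\<lambda>r. x + r *\<^sub>R h) ` {0..1})"
      by (rule has_derivative_subset[OF grad[OF incb[OF that]]]) (use incb in auto)
    moreover have "((\<lambda>r. x + r *\<^sub>R h) has_derivative (\<lambda>u. u *\<^sub>R h)) (at r within {0..1})"
      by (auto intro!: derivative_eq_intros)
    ultimately show ?thesis
      by (rule has_derivative_in_compose[rotated])
  qed
  have slope: "\<bar>(g (x + r *\<^sub>R h) - g x) \<bullet> h\<bar> \<le> B * r * (norm h)\<^sup>2" if "0 \<le> r" "r \<le> 1" for r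
  proof -
    have "\<bar>(g (x + r *\<^sub>R h) - g x) \<bullet> h\<bar> \<le> norm (g (x + r *\<^sub>R h) - g x) * norm h"
      by (rule Cauchy_Schwarz_ineq2)
    also have "\<dots> \<le> B * norm ((x + r *\<^sub>R h) - x) * norm h"
      by (intro mult_right_mono lip incb that) auto
    finally show ?thesis using that by (simp add: power2_eq_square mult_ac)
  qed
  have main: "\<sigma> * (\<phi> (x + h) - \<phi> x - g x \<bullet> h) \<le> B / 2 * (norm h)\<^sup>2" if \<sigma>: "\<bar>\<sigma>\<bar> = 1" for \<sigma> :: real
  proof -
    \<comment> \<open>The quadratic term is the primitive of the slope bound, so the derivative of
      \<open>?f\<close> in r is nonpositive; the mean value theorem without this term would give B
      instead of B / 2. The sign \<open>\<sigma>\<close> covers both directions of the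
      estimate.\<close>
    let ?f = "\<lambda>r. \<sigma> * (\<phi> (x + r *\<^sub>R h) - r * (g x \<bullet> h)) - B / 2 * (norm h)\<^sup>2 * r\<^sup>2"
    let ?f' = "\<lambda>r u. \<sigma> * (g (x + r *\<^sub>R h) \<bullet> (u *\<^sub>R h) - u * (g x \<bullet> h)) - B / 2 * (norm h)\<^sup>2 * (2 * r * u)"
    have "(?f has_derivative ?f' r) (at r within {0..1})" if "0 \<le> r" "r \<le> 1" for r
      by (rule derivative_eq_intros refl D that | simp add: mult_ac)+
    from mvt_simple[of 0 1 ?f ?f', OF _ this]
    obtain r where r: "0 < r" "r < 1" "?f 1 - ?f 0 = ?f' r 1" by auto
    have "\<sigma> * ((g (x + r *\<^sub>R h) - g x) \<bullet> h) \<le> B * r * (norm h)\<^sup>2"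
    proof -
      have "\<sigma> * ((g (x + r *\<^sub>R h) - g x) \<bullet> h) \<le> \<bar>\<sigma>\<bar> * \<bar>(g (x + r *\<^sub>R h) - g x) \<bullet> h\<bar>"
        by (metis abs_ge_self abs_mult)
      then show ?thesis using slope[of r] r \<sigma> by auto
    qed
    then have "?f' r 1 \<le> 0" by (simp add: inner_diff_left algebra_simps)
    then have "?f 1 - ?f 0 \<le> 0" using r(3) by linarith
    then show ?thesis by (simp add: algebra_simps)
  qed
  show ?thesis using main[of 1] main[of "-1"] by (auto simp: abs_if)
qed

text \<open>Two separate Taylor expansions would not give an error proportional to |h - k|. The mean
  value inequality for \<open>\<phi>\<close> minus its linear part at x does, since on the ball of
  radius t that difference has gradient at most B t. The factor |h - k| later becomes the distance
  between two directions.\<close>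

lemma gradient_increment_bound:
  fixes \<phi> :: "'a::euclidean_space \<Rightarrow> real" and g :: "'a \<Rightarrow> 'a"
  assumes grad: "\<And>z. z \<in> cball x \<eta> \<Longrightarrow> (\<phi> has_derivative (\<lambda>h. g z \<bullet> h)) (at z within cball x \<eta>)"
    and lip: "\<And>z. z \<in> cball x \<eta> \<Longrightarrow> norm (g z - g x) \<le> B * norm (z - x)"
    and "B \<ge> 0" "t \<le> \<eta>" "h \<in> cball 0 t" "k \<in> cball 0 t"
  shows "\<bar>\<phi> (x + h) - \<phi> (x + k) - g x \<bullet> (h - k)\<bar> \<le> B * t * norm (h - k)"
proof -
  have "norm ((\<phi> (x + h) - g x \<bullet> (x + h)) - (\<phi> (x + k) - g x \<bullet> (x + k))) \<le> B * t * norm ((x + h) - (x + k))"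
  proof (rule differentiable_bound[of "cball x t" "\<lambda>z. \<phi> z - g x \<bullet> z" "\<lambda>z h. g z \<bullet> h - g x \<bullet> h"])
    fix z assume z: "z \<in> cball x t"
    have sub: "cball x t \<subseteq> cball x \<eta>" using assms by auto
    show "((\<lambda>z. \<phi> z - g x \<bullet> z) has_derivative (\<lambda>h. g z \<bullet> h - g x \<bullet> h)) (at z within cball x t)"
      by (intro derivative_intros has_derivative_subset[OF grad sub]) (use z sub in auto)
    have "norm (g z - g x) \<le> B * t"
    proof -
      have "norm (g z - g x) \<le> B * norm (z - x)" using lip z sub by auto
      also have "\<dots> \<le> B * t" using z \<open>B \<ge> 0\<close> by (intro mult_left_mono) (auto simp: dist_norm norm_minus_commute)
      finally show ?thesis .
    qed
    then show "onorm (\<lambda>h. g z \<bullet> h - g x \<bullet> h) \<le> B * t"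
      by (intro onorm_le) (smt (verit) Cauchy_Schwarz_ineq2 inner_diff_left mult_right_mono norm_ge_zero real_norm_def)
  qed (use assms in \<open>auto simp: dist_norm\<close>)
  then show ?thesis by (simp add: algebra_simps inner_diff_right inner_add_right)
qed

section \<open>Arcs and chords on the unit sphere\<close>

lemma half_le_sin:
  fixes y :: real
  assumes "0 \<le> y" "y \<le> pi / 2"
  shows "y / 2 \<le> sin y"
proof (cases "y = 0")
  case False
  with assms have "y > 0" by simp
  then obtain t where "sin y = (\<Sum>m<3. sin_coeff m * y ^ m) + (sin (t + 1/2 * real 3 * pi) / fact 3) * y ^ 3"
    using Maclaurin_sin_expansion3[of 3 y] by auto
  moreover have "(\<Sum>m<3. sin_coeff m * y ^ m) = y"
    by (simp add: numeral_3_eq_3 sin_coeff_def)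
  moreover have "- (y ^ 3 / 6) \<le> (sin (t + 1/2 * real 3 * pi) / fact 3) * y ^ 3"
  proof -
    have "- 1 * y ^ 3 \<le> sin (t + 1/2 * real 3 * pi) * y ^ 3"
      using \<open>y > 0\<close> by (intro mult_right_mono) auto
    then show ?thesis by (simp add: fact_numeral)
  qed
  \<comment> \<open>This is what turns the cubic lower bound y - y^3 / 6 into y / 2.\<close>
  moreover have "y ^ 3 \<le> 3 * y"
  proof -
    have "y \<le> 1.7" using assms pi_less_4 pi_approx by simp
    then have "y * y \<le> 1.7 * 1.7" using \<open>y > 0\<close> by (intro mult_mono) auto
    then have "y * y \<le> 3" by simp
    then have "y * (y * y) \<le> y * 3" using \<open>y > 0\<close> by (intro mult_left_mono) auto
    then show ?thesis by (simp add: power3_eq_cube)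
  qed
  ultimately show ?thesis by linarith
qed simp

text \<open>Gram-Schmidt: \<open>w\<close> is the normalised part of \<open>v\<close> orthogonal to
  \<open>u\<close>, and the angle is the arccosine of \<open>u \<bullet> v\<close>.\<close>

lemma unit_vectors_on_arc:
  fixes u v :: "'a::euclidean_space"
  assumes "norm u = 1" "norm v = 1" "2 \<le> DIM('a)"
  obtains w \<theta> where "norm w = 1" "u \<bullet> w = 0" "0 \<le> \<theta>" "\<theta> \<le> pi" "v = cos \<theta> *\<^sub>R u + sin \<theta> *\<^sub>R w"
proof -
  define c where "c = u \<bullet> v"
  define r where "r = v - c *\<^sub>R u"
  have c1: "\<bar>c\<bar> \<le> 1" unfolding c_def using Cauchy_Schwarz_ineq2[of u v] assms by simp
  have uu: "u \<bullet> u = 1" "v \<bullet> v = 1" using assms by (simp_all add: dot_square_norm)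
  have ur: "u \<bullet> r = 0" unfolding r_def c_def by (simp add: inner_diff_right uu)
  have "r \<bullet> r = 1 - c\<^sup>2"
    unfolding r_def by (simp add: inner_diff_left inner_diff_right uu power2_eq_square inner_commute)
       (simp add: c_def inner_commute)
  then have nr: "norm r = sqrt (1 - c\<^sup>2)" by (simp add: norm_eq_sqrt_inner)
  define \<theta> where "\<theta> = arccos c"
  have th: "0 \<le> \<theta>" "\<theta> \<le> pi" "cos \<theta> = c" "sin \<theta> = sqrt (1 - c\<^sup>2)"
    using c1 unfolding \<theta>_def by (auto simp: abs_le_iff arccos_lbound arccos_ubound cos_arccos sin_arccos_abs)
  show ?thesis
  proof (cases "r = 0")
    case True
    \<comment> \<open>Here v is u or - u and determines no plane, so any direction orthogonal to u
      is taken; one exists in dimension at least two.\<close>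
    obtain z where z: "z \<noteq> 0" "orthogonal u z" using orthogonal_to_vector_exists assms(3) by blast
    show ?thesis
    proof (rule that[of "z /\<^sub>R norm z" \<theta>])
      show "v = cos \<theta> *\<^sub>R u + sin \<theta> *\<^sub>R (z /\<^sub>R norm z)"
        using True nr th unfolding r_def by simp
    qed (use z th in \<open>auto simp: orthogonal_def\<close>)
  next
    case False
    show ?thesis
    proof (rule that[of "r /\<^sub>R norm r" \<theta>])
      show "v = cos \<theta> *\<^sub>R u + sin \<theta> *\<^sub>R (r /\<^sub>R norm r)"
      proof -
        have "sin \<theta> = norm r" using nr th(4) by simp
        then have "sin \<theta> *\<^sub>R (r /\<^sub>R norm r) = r" using False by simp
        then show ?thesis using th unfolding r_def by simp
      qed
    qed (use False th ur in auto)
  qed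
qed

lemma norm_arc_diff:
  fixes u w :: "'a::real_inner"
  assumes "norm u = 1" "norm w = 1" "u \<bullet> w = 0"
  shows "norm ((cos \<alpha> *\<^sub>R u + sin \<alpha> *\<^sub>R w) - (cos \<beta> *\<^sub>R u + sin \<beta> *\<^sub>R w)) = 2 * \<bar>sin ((\<alpha> - \<beta>) / 2)\<bar>"
proof -
  have n: "u \<bullet> u = 1" "w \<bullet> w = 1" "w \<bullet> u = 0" using assms by (simp_all add: dot_square_norm inner_commute)
  have "(norm ((cos \<alpha> *\<^sub>R u + sin \<alpha> *\<^sub>R w) - (cos \<beta> *\<^sub>R u + sin \<beta> *\<^sub>R w)))\<^sup>2
    = (cos \<alpha> - cos \<beta>)\<^sup>2 + (sin \<alpha> - sin \<beta>)\<^sup>2"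
    unfolding power2_norm_eq_inner
    by (simp only: inner_add_left inner_add_right inner_diff_left inner_diff_right
        inner_scaleR_left inner_scaleR_right n assms(3)) (simp add: power2_eq_square algebra_simps)
  also have "\<dots> = ((sin \<alpha>)\<^sup>2 + (cos \<alpha>)\<^sup>2) + ((sin \<beta>)\<^sup>2 + (cos \<beta>)\<^sup>2) - 2 * cos (\<alpha> - \<beta>)"
    by (simp add: cos_diff power2_eq_square algebra_simps)
  also have "\<dots> = 2 - 2 * cos (2 * ((\<alpha> - \<beta>) / 2))"
    by (simp add: sin_squared_eq del: distrib_left_numeral right_diff_distrib_numeral)
  also have "\<dots> = (2 * \<bar>sin ((\<alpha> - \<beta>) / 2)\<bar>)\<^sup>2"
    by (subst cos_double_sin) (simp add: power_mult_distrib)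
  finally show ?thesis by (rule power2_eq_imp_eq) auto
qed

text \<open>The exterior of a ball is not convex, so the usual subadditivity argument for a modulus
  of continuity has to follow a great-circle arc instead of a segment. An arc is at most twice as
  long as its chord, which costs a factor 2.\<close>

lemma sphere_chain_bound:
  fixes \<phi> :: "'a::euclidean_space \<Rightarrow> real"
  assumes dim: "2 \<le> DIM('a)" and uv: "norm u = 1" "norm v = 1" and "t > 0"
    and step: "\<And>z w. dist x z = t \<Longrightarrow> dist x w = t \<Longrightarrow> dist z w \<le> norm (u - v) \<Longrightarrow> \<bar>\<phi> z - \<phi> w\<bar> \<le> m"
    and "m \<ge> 0"
  shows "\<bar>\<phi> (x + t *\<^sub>R u) - \<phi> (x + t *\<^sub>R v)\<bar> \<le> (2 + 2 * t) * m"
proof -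
  obtain w \<theta> where w: "norm w = 1" "u \<bullet> w = 0" "0 \<le> \<theta>" "\<theta> \<le> pi" and v: "v = cos \<theta> *\<^sub>R u + sin \<theta> *\<^sub>R w"
    using unit_vectors_on_arc[OF uv dim] by metis
  define \<gamma> where "\<gamma> r = cos r *\<^sub>R u + sin r *\<^sub>R w" for r :: real
  \<comment> \<open>The arc at radius t has length t \<theta>, and \<theta> / 2 is at most the chord
    |u - v|. At least 2 t equal pieces therefore bring each step down to |u - v|.\<close>
  define n where "n = nat \<lceil>2 * t\<rceil>"
  have n: "2 * t \<le> real n" "real n \<le> 2 * t + 1" "n > 0"
    unfolding n_def using \<open>t > 0\<close> by linarith+
  have \<gamma>0: "\<gamma> 0 = u" and \<gamma>\<theta>: "\<gamma> \<theta> = v" unfolding \<gamma>_def v by auto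
  have d\<gamma>: "norm (\<gamma> \<alpha> - \<gamma> \<beta>) = 2 * \<bar>sin ((\<alpha> - \<beta>) / 2)\<bar>" for \<alpha> \<beta>
    unfolding \<gamma>_def by (rule norm_arc_diff[OF uv(1) w(1,2)])
  \<comment> \<open>Antipodal points of the curve are at chord distance 2, so the chord formula
    already contains the unit norm.\<close>
  have n\<gamma>: "norm (\<gamma> r) = 1" for r
  proof -
    have "norm (\<gamma> r - \<gamma> (r + pi)) = 2" by (subst d\<gamma>) simp
    moreover have "\<gamma> (r + pi) = - \<gamma> r" unfolding \<gamma>_def by simp
    ultimately have "norm (2 *\<^sub>R \<gamma> r) = 2" by (simp add: scaleR_2)
    then show ?thesis by simp
  qed
  have chord: "\<theta> / 2 \<le> norm (u - v)"
  proof -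
    have "norm (u - v) = 2 * sin (\<theta> / 2)"
      using d\<gamma>[of \<theta> 0] w sin_ge_zero[of "\<theta>/2"] by (simp add: \<gamma>0 \<gamma>\<theta> norm_minus_commute)
    moreover have "\<theta> / 2 / 2 \<le> sin (\<theta> / 2)" using w by (intro half_le_sin) auto
    ultimately show ?thesis by simp
  qed
  define q where "q k = \<phi> (x + t *\<^sub>R \<gamma> (real k * \<theta> / real n))" for k :: nat
  have "\<bar>q (Suc k) - q k\<bar> \<le> m" for k
    unfolding q_def
  proof (rule step)
    have "dist (x + t *\<^sub>R \<gamma> (real (Suc k) * \<theta> / real n)) (x + t *\<^sub>R \<gamma> (real k * \<theta> / real n))
       = t * norm (\<gamma> (real (Suc k) * \<theta> / real n) - \<gamma> (real k * \<theta> / real n))"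
      using \<open>t > 0\<close> by (simp add: dist_norm flip: scaleR_diff_right)
    also have "\<dots> = t * (2 * \<bar>sin (\<theta> / real n / 2)\<bar>)"
      unfolding d\<gamma> by (simp add: distrib_right add_divide_distrib)
    also have "\<dots> \<le> t * (2 * (\<theta> / real n / 2))"
      using \<open>t > 0\<close> abs_sin_x_le_abs_x[of "\<theta> / real n / 2"] w(3) n by (intro mult_left_mono) auto
    also have "\<dots> = (2 * t) * (\<theta> / 2) / real n" by simp
    also have "\<dots> \<le> real n * (\<theta> / 2) / real n"
      using n w by (intro divide_right_mono mult_right_mono) auto
    also have "\<dots> \<le> norm (u - v)" using chord n by simp
    finally show "dist (x + t *\<^sub>R \<gamma> (real (Suc k) * \<theta> / real n)) (x + t *\<^sub>R \<gamma> (real k * \<theta> / real n)) \<le> norm (u - v)" .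
  qed (use \<open>t > 0\<close> in \<open>auto simp: dist_norm n\<gamma>\<close>)
  then have *: "\<bar>q k - q 0\<bar> \<le> real k * m" for k
  proof (induction k)
    case (Suc k)
    from Suc.IH[OF Suc.prems] Suc.prems[of k] show ?case by (simp add: algebra_simps)
  qed simp
  have "\<bar>\<phi> (x + t *\<^sub>R u) - \<phi> (x + t *\<^sub>R v)\<bar> = \<bar>q n - q 0\<bar>"
    unfolding q_def using n by (simp add: \<gamma>0 \<gamma>\<theta>)
  also have "\<dots> \<le> real n * m" by (rule *)
  \<comment> \<open>The number of pieces is at most 2 t + 1. The form 2 + 2 t integrates to twice
    the combination of powers of \<eta> that multiplies the modulus in \<open>E_eps\<close>.\<close>
  also have "\<dots> \<le> (2 + 2 * t) * m" using n \<open>m \<ge> 0\<close> by (intro mult_right_mono) auto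
  finally show ?thesis .
qed

section \<open>The exterior modulus of continuity and the Hessian bound\<close>

lemma omega_phi_upper:
  fixes \<phi> :: "'a::euclidean_space \<Rightarrow> real"
  assumes "bounded (range \<phi>)" "z \<notin> cball x \<eta>" "w \<notin> cball x \<eta>" "dist z w \<le> a"
  shows "\<bar>\<phi> z - \<phi> w\<bar> \<le> omega_phi \<phi> x \<eta> a"
  unfolding omega_phi_def
proof (rule cSup_upper)
  obtain b where b: "\<And>z. \<bar>\<phi> z\<bar> \<le> b" using assms(1) by (auto simp: bounded_iff)
  have "\<bar>\<phi> z - \<phi> w\<bar> \<le> 2 * b" for z w using b[of z] b[of w] by linarith
  then show "bdd_above {\<bar>\<phi> z - \<phi> w\<bar> |z w. z \<notin> cball x \<eta> \<and> w \<notin> cball x \<eta> \<and> dist z w \<le> a}"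
    by (auto intro!: bdd_aboveI[of _ "2 * b"])
qed (use assms in blast)

lemma exterior_cball_nonempty:
  fixes x :: "'a::euclidean_space"
  obtains z where "z \<notin> cball x \<eta>"
  by (metis UNIV_eq_I bounded_cball not_bounded_UNIV)

lemma omega_phi_mono:
  fixes \<phi> :: "'a::euclidean_space \<Rightarrow> real"
  assumes "bounded (range \<phi>)" "0 \<le> a" "a \<le> b"
  shows "omega_phi \<phi> x \<eta> a \<le> omega_phi \<phi> x \<eta> b"
proof -
  obtain z where "z \<notin> cball x \<eta>" by (rule exterior_cball_nonempty)
  \<comment> \<open>Pairing an exterior point with itself gives a member, as the least-upper-bound
    rule for a real supremum requires.\<close>
  then have "{\<bar>\<phi> z - \<phi> w\<bar> |z w. z \<notin> cball x \<eta> \<and> w \<notin> cball x \<eta> \<and> dist z w \<le> a} \<noteq> {}"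
    using assms by (auto intro!: exI[of _ z])
  then show ?thesis
    by (subst omega_phi_def, intro cSup_least) (use assms in \<open>auto intro!: omega_phi_upper\<close>)
qed

lemma omega_phi_nonneg:
  fixes \<phi> :: "'a::euclidean_space \<Rightarrow> real"
  assumes "bounded (range \<phi>)" "0 \<le> a"
  shows "0 \<le> omega_phi \<phi> x \<eta> a"
proof -
  obtain z where "z \<notin> cball x \<eta>" by (rule exterior_cball_nonempty)
  from omega_phi_upper[OF assms(1) this this, of a] assms(2) show ?thesis by simp
qed

text \<open>The constant \<open>C_x\<close> is a supremum over the open ball, whereas the mean value
  inequality is applied on the closed one. For each fixed v the bound on \<open>H z v\<close> passes
  to the closure by continuity.\<close>

lemma onorm_Sup_bound_on_cball:
  fixes H :: "'a::euclidean_space \<Rightarrow> 'a \<Rightarrow> 'a"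
  assumes "\<eta> > 0" and lin: "\<And>z. z \<in> cball x \<eta> \<Longrightarrow> bounded_linear (H z)"
    and cont: "\<And>v. continuous_on (cball x \<eta>) (\<lambda>z. H z v)"
    and "z \<in> cball x \<eta>"
  shows "onorm (H z) \<le> (SUP z\<in>ball x \<eta>. onorm (H z))"
proof -
  \<comment> \<open>The supremum must first be shown finite. Continuity is given only for each fixed
    v, so the operator norm is controlled through the finitely many basis vectors.\<close>
  have "\<exists>b. \<forall>z\<in>cball x \<eta>. norm (H z v) \<le> b" for v
  proof -
    have "bounded ((\<lambda>z. H z v) ` cball x \<eta>)"
      by (intro compact_imp_bounded compact_continuous_image cont compact_cball)
    then show ?thesis by (auto simp: bounded_iff)
  qed
  then obtain b where b: "\<And>v z. z \<in> cball x \<eta> \<Longrightarrow> norm (H z v) \<le> b v" by metis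
  have "onorm (H z) \<le> (\<Sum>i\<in>Basis. b i)" if z: "z \<in> cball x \<eta>" for z
  proof -
    have "onorm (H z) \<le> (\<Sum>i\<in>Basis. norm (H z i))"
      by (rule onorm_componentwise[OF lin[OF z]])
    also have "\<dots> \<le> (\<Sum>i\<in>Basis. b i)" by (intro sum_mono b z)
    finally show ?thesis .
  qed
  then have bdd: "bdd_above ((\<lambda>z. onorm (H z)) ` ball x \<eta>)"
    by (intro bdd_aboveI[of _ "\<Sum>i\<in>Basis. b i"]) auto
  show ?thesis
  proof (rule onorm_le)
    fix v
    show "norm (H z v) \<le> (SUP z\<in>ball x \<eta>. onorm (H z)) * norm v"
    proof (rule continuous_on_closure_norm_le[of "ball x \<eta>" "\<lambda>z. H z v"])
      show "\<forall>y\<in>ball x \<eta>. norm (H y v) \<le> (SUP z\<in>ball x \<eta>. onorm (H z)) * norm v"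
      proof
        fix y assume y: "y \<in> ball x \<eta>"
        have "norm (H y v) \<le> onorm (H y) * norm v" by (rule onorm) (use y lin in auto)
        also have "\<dots> \<le> (SUP z\<in>ball x \<eta>. onorm (H z)) * norm v"
          by (intro mult_right_mono cSUP_upper y bdd) auto
        finally show "norm (H y v) \<le> (SUP z\<in>ball x \<eta>. onorm (H z)) * norm v" .
      qed
    qed (use assms in auto)
  qed
qed

section \<open>The measure \<open>mu_s\<close> and its tails\<close>

lemma C_s_pos:
  assumes "1/2 < s" "s < 1"
  shows "C_s s > 0"
  unfolding C_s_def using assms by (intro divide_pos_pos mult_pos_pos Gamma_real_pos) auto

text \<open>Takes the constant and the density out of the measure, so that all later estimates are
  made against \<open>lborel\<close>.\<close>

lemma set_integral_mu_s:
  fixes f :: "real \<Rightarrow> real"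
  assumes s: "1/2 < s" "s < 1" and [measurable]: "f \<in> borel_measurable borel" "A \<in> sets borel"
    and A: "A \<subseteq> {0<..}"
  shows "(LINT t:A|mu_s s. f t) = C_s s * (LINT t:A|lborel. t powr (-1 - 2 * s) * f t)"
proof -
  have "(LINT t:A|mu_s s. f t) =
      (LINT t|lborel. (indicator {0<..} t * (C_s s * t powr (-1 - 2 * s))) *\<^sub>R (indicator A t *\<^sub>R f t))"
    unfolding set_lebesgue_integral_def mu_s_def
    using C_s_pos[OF s] by (intro integral_density) auto
  also have "\<dots> = (LINT t|lborel. C_s s * (indicator A t *\<^sub>R (t powr (-1 - 2 * s) * f t)))"
    using A by (intro Bochner_Integration.integral_cong) (auto simp: indicator_def)
  finally show ?thesis by (simp add: set_lebesgue_integral_def)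
qed

lemma measure_mu_s_tail:
  assumes s: "1/2 < s" "s < 1" and "a > 0"
  shows "measure (mu_s s) {a<..} = C_s s * (a powr (-2 * s) / (2 * s))"
proof -
  have "measure (mu_s s) {a<..} = (LINT t:{a<..}|mu_s s. 1)"
    by (simp add: set_lebesgue_integral_def mu_s_def)
  also have "\<dots> = C_s s * (LINT t:{a<..}|lborel. t powr (-1 - 2 * s) * 1)"
    using assms by (intro set_integral_mu_s) auto
  also have "\<dots> = C_s s * (a powr (-2 * s) / (2 * s))"
    using assms by (simp add: set_integrable_lborel_powr_tail(2))
  finally show ?thesis .
qed

section \<open>Integrated increments along rays\<close>

text \<open>Second derivatives enter only through \<open>B\<close>, which stands for 2 C_x and
  bounds the variation of the gradient from its value at x.\<close>

locale taylor_point =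
  fixes s \<eta> B :: real and x :: "'a::euclidean_space" and \<phi> :: "'a \<Rightarrow> real" and g :: "'a \<Rightarrow> 'a"
  assumes s: "1/2 < s" "s < 1"
    and \<eta>: "\<eta> > 0"
    and bdd: "bounded (range \<phi>)"
    and borel: "\<phi> \<in> borel_measurable borel"
    and grad: "\<And>z. z \<in> cball x \<eta> \<Longrightarrow> (\<phi> has_derivative (\<lambda>h. g z \<bullet> h)) (at z within cball x \<eta>)"
    and B: "B \<ge> 0"
    and lip: "\<And>z. z \<in> cball x \<eta> \<Longrightarrow> norm (g z - g x) \<le> B * norm (z - x)"
begin

definition G :: "real \<Rightarrow> 'a \<Rightarrow> real" where
  "G a y = (LINT t:{a<..}|lborel. t powr (-1 - 2 * s) * (\<phi> (x + t *\<^sub>R y) - \<phi> x))"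

lemma measurable_ray [measurable]: "(\<lambda>t. \<phi> (x + t *\<^sub>R y)) \<in> borel_measurable borel"
  by (rule measurable_compose[OF _ borel]) measurable

lemma set_integrable_weighted:
  fixes f :: "real \<Rightarrow> real"
  assumes "a > 0" and [measurable]: "f \<in> borel_measurable borel" and "\<And>t. \<bar>f t\<bar> \<le> b"
  shows "set_integrable lborel {a<..} (\<lambda>t. t powr (-1 - 2 * s) * f t)"
proof (rule set_integrable_bound)
  show "set_integrable lborel {a<..} (\<lambda>t. t powr (-1 - 2 * s) * b)"
    using assms s by (intro set_integrable_mult_left set_integrable_lborel_powr_tail) auto
  show "set_borel_measurable lborel {a<..} (\<lambda>t. t powr (-1 - 2 * s) * f t)"
    unfolding set_borel_measurable_def by measurable
  show "AE t in lborel. t \<in> {a<..} \<longrightarrow> norm (t powr (-1 - 2 * s) * f t) \<le> norm (t powr (-1 - 2 * s) * b)"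
    using assms(3) by (auto simp: abs_mult intro!: mult_left_mono order_trans[OF _ abs_ge_self])
qed

lemma increment_bounded:
  obtains b where "\<And>z w. \<bar>\<phi> z - \<phi> w\<bar> \<le> b"
proof -
  obtain b where b: "\<And>z. \<bar>\<phi> z\<bar> \<le> b" using bdd by (auto simp: bounded_iff)
  have "\<bar>\<phi> z - \<phi> w\<bar> \<le> 2 * b" for z w using b[of z] b[of w] by linarith
  then show ?thesis by (rule that)
qed

lemma set_integrable_G:
  assumes "a > 0"
  shows "set_integrable lborel {a<..} (\<lambda>t. t powr (-1 - 2 * s) * (\<phi> (x + t *\<^sub>R y) - \<phi> x))"
proof -
  obtain b where "\<And>z w. \<bar>\<phi> z - \<phi> w\<bar> \<le> b" by (rule increment_bounded) blast
  then show ?thesis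
    by (intro set_integrable_weighted[OF assms, of _ b] borel_measurable_diff measurable_ray borel_measurable_const)
qed

text \<open>Uniformity in y makes the real suprema and infima of \<open>G a\<close> over the sphere
  genuine ones.\<close>

lemma G_bounded:
  assumes "a > 0"
  obtains K where "\<And>y. \<bar>G a y\<bar> \<le> K"
proof -
  obtain b where b: "\<And>z w. \<bar>\<phi> z - \<phi> w\<bar> \<le> b" by (rule increment_bounded) blast
  have "\<bar>G a y\<bar> \<le> (LINT t:{a<..}|lborel. t powr (-1 - 2 * s) * b)" for y
    unfolding G_def
  proof (rule abs_set_integral_le)
    show "set_integrable lborel {a<..} (\<lambda>t. t powr (-1 - 2 * s) * b)"
      using assms s by (intro set_integrable_mult_left set_integrable_lborel_powr_tail) auto
    show "\<bar>t powr (-1 - 2 * s) * (\<phi> (x + t *\<^sub>R y) - \<phi> x)\<bar> \<le> t powr (-1 - 2 * s) * b" for t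
      unfolding abs_mult using b by (intro mult_mono) auto
  qed (rule set_integrable_G[OF assms])
  then show ?thesis using that by blast
qed

lemma G_split:
  assumes "0 < \<delta>" "\<delta> \<le> \<epsilon>"
  shows "G \<delta> y = (LINT t:{\<delta><..\<epsilon>}|lborel. t powr (-1 - 2 * s) * (\<phi> (x + t *\<^sub>R y) - \<phi> x)) + G \<epsilon> y"
    and "set_integrable lborel {\<delta><..\<epsilon>} (\<lambda>t. t powr (-1 - 2 * s) * (\<phi> (x + t *\<^sub>R y) - \<phi> x))"
proof -
  show i: "set_integrable lborel {\<delta><..\<epsilon>} (\<lambda>t. t powr (-1 - 2 * s) * (\<phi> (x + t *\<^sub>R y) - \<phi> x))"
    by (rule set_integrable_subset[OF set_integrable_G[OF assms(1)]]) auto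
  have "{\<delta><..} = {\<delta><..\<epsilon>} \<union> {\<epsilon><..}" using assms by auto
  then show "G \<delta> y = (LINT t:{\<delta><..\<epsilon>}|lborel. t powr (-1 - 2 * s) * (\<phi> (x + t *\<^sub>R y) - \<phi> x)) + G \<epsilon> y"
    unfolding G_def using assms i by (simp add: set_integral_Un set_integrable_G disjoint_iff)
qed

lemma integral_Lphi:
  assumes "\<delta> > 0"
  shows "(LINT t:{\<delta><..}|mu_s s. Lphi \<phi> x (t *\<^sub>R y) (t *\<^sub>R y')) = C_s s * (G \<delta> y + G \<delta> (- y'))"
proof -
  have m: "(\<lambda>t. Lphi \<phi> x (t *\<^sub>R y) (t *\<^sub>R y')) \<in> borel_measurable borel"
    using measurable_ray[of y] measurable_ray[of "-y'"] unfolding Lphi_def by simp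
  have "(LINT t:{\<delta><..}|mu_s s. Lphi \<phi> x (t *\<^sub>R y) (t *\<^sub>R y'))
     = C_s s * (LINT t:{\<delta><..}|lborel. t powr (-1 - 2 * s) * Lphi \<phi> x (t *\<^sub>R y) (t *\<^sub>R y'))"
    using assms by (intro set_integral_mu_s s m) auto
  also have "(\<lambda>t. t powr (-1 - 2 * s) * Lphi \<phi> x (t *\<^sub>R y) (t *\<^sub>R y')) =
     (\<lambda>t. t powr (-1 - 2 * s) * (\<phi> (x + t *\<^sub>R y) - \<phi> x) + t powr (-1 - 2 * s) * (\<phi> (x + t *\<^sub>R (- y')) - \<phi> x))"
    by (simp add: Lphi_def algebra_simps)
  finally show ?thesis
    unfolding G_def using assms set_integrable_G[of \<delta> y] set_integrable_G[of \<delta> "- y'"]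
    by (simp add: set_integral_add)
qed

lemma favg_ray:
  assumes "\<epsilon> > 0"
  shows "favg s \<epsilon> (\<lambda>t. \<phi> (x + t *\<^sub>R y)) = \<phi> x + 2 * s * \<epsilon> powr (2 * s) * G \<epsilon> y"
proof -
  have P: "(LINT t:{\<epsilon><..}|lborel. t powr (-1 - 2 * s)) = \<epsilon> powr (-2 * s) / (2 * s)"
    "set_integrable lborel {\<epsilon><..} (\<lambda>t. t powr (-1 - 2 * s) * \<phi> x)"
    using s assms by (simp_all add: set_integrable_lborel_powr_tail)
  have "(LINT t:{\<epsilon><..}|mu_s s. \<phi> (x + t *\<^sub>R y)) = C_s s * (LINT t:{\<epsilon><..}|lborel. t powr (-1 - 2 * s) * \<phi> (x + t *\<^sub>R y))"
    using assms by (intro set_integral_mu_s s measurable_ray) auto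
  also have "(\<lambda>t. t powr (-1 - 2 * s) * \<phi> (x + t *\<^sub>R y)) =
     (\<lambda>t. t powr (-1 - 2 * s) * \<phi> x + t powr (-1 - 2 * s) * (\<phi> (x + t *\<^sub>R y) - \<phi> x))"
    by (simp add: algebra_simps)
  also have "(LINT t:{\<epsilon><..}|lborel. t powr (-1 - 2 * s) * \<phi> x + t powr (-1 - 2 * s) * (\<phi> (x + t *\<^sub>R y) - \<phi> x))
     = \<epsilon> powr (-2 * s) / (2 * s) * \<phi> x + G \<epsilon> y"
    unfolding G_def using P set_integrable_G[OF assms] by (subst set_integral_add(2)) auto
  finally have "favg s \<epsilon> (\<lambda>t. \<phi> (x + t *\<^sub>R y)) =
     C_s s * (\<epsilon> powr (-2 * s) / (2 * s) * \<phi> x + G \<epsilon> y) / (C_s s * (\<epsilon> powr (-2 * s) / (2 * s)))"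
    unfolding favg_def measure_mu_s_tail[OF s assms] by (rule arg_cong)
  also have "\<dots> = \<phi> x + 2 * s * \<epsilon> powr (2 * s) * G \<epsilon> y"
    using C_s_pos[OF s] s assms by (simp add: powr_minus field_simps)
  finally show ?thesis .
qed

lemma Ao_eq:
  assumes "\<epsilon> > 0"
  shows "Ao s \<epsilon> \<phi> x - \<phi> x = s * \<epsilon> powr (2 * s) * ((SUP y\<in>sphere 0 1. G \<epsilon> y) + (INF y\<in>sphere 0 1. G \<epsilon> y))"
proof -
  obtain K where K: "\<And>y. \<bar>G \<epsilon> y\<bar> \<le> K" by (rule G_bounded[OF assms]) blast
  have ne: "sphere (0::'a) 1 \<noteq> {}" by simp
  have b: "bdd_above (G \<epsilon> ` sphere 0 1)" "bdd_below (G \<epsilon> ` sphere 0 1)"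
    using K by (auto intro!: bdd_aboveI[of _ K] bdd_belowI[of _ "-K"] simp: abs_le_iff) (metis minus_le_iff)
  \<comment> \<open>Each ray average is this increasing affine function of
    \<open>G \<epsilon> y\<close>; being monotone and continuous, it commutes with supremum and
    infimum of bounded nonempty sets.\<close>
  define q where "q r = \<phi> x + 2 * s * \<epsilon> powr (2 * s) * r" for r
  have q: "mono q" "continuous_on UNIV q"
    unfolding q_def using s by (auto intro!: monoI mult_left_mono continuous_intros)
  have "q (SUP y\<in>sphere 0 1. G \<epsilon> y) = (SUP y\<in>sphere 0 1. q (G \<epsilon> y))"
    using continuous_at_Sup_mono[OF q(1) _ _ b(1)] q(2) ne
    by (simp add: image_image continuous_at_imp_continuous_at_within continuous_on_eq_continuous_at)
  moreover have "q (INF y\<in>sphere 0 1. G \<epsilon> y) = (INF y\<in>sphere 0 1. q (G \<epsilon> y))"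
    using continuous_at_Inf_mono[OF q(1) _ _ b(2)] q(2) ne
    by (simp add: image_image continuous_at_imp_continuous_at_within continuous_on_eq_continuous_at)
  ultimately show ?thesis
    unfolding Ao_def favg_ray[OF assms] by (simp add: q_def[symmetric]) (simp add: q_def algebra_simps)
qed

text \<open>The first-order term diverges like \<delta> to the power 1 - 2 s, so its exact integral
  over (\<delta>, \<epsilon>] is subtracted. The two Taylor remainders add up to at most B t^2, and
  against the weight this is B t to the power 1 - 2 s, integrable at 0 because s < 1.\<close>

lemma G_limit:
  assumes "0 < \<epsilon>" "\<epsilon> \<le> \<eta>" "norm y = 1" "norm y' = 1"
  obtains \<rho> where "\<bar>\<rho>\<bar> \<le> B / 2 * \<epsilon> powr (2 - 2 * s) / (1 - s)"
    "((\<lambda>\<delta>. G \<delta> y + G \<delta> (- y') - g x \<bullet> (y - y') * ((\<delta> powr (1 - 2 * s) - \<epsilon> powr (1 - 2 * s)) / (2 * s - 1)))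
       \<longlongrightarrow> G \<epsilon> y + G \<epsilon> (- y') + \<rho>) (at_right 0)"
proof -
  define c where "c = g x \<bullet> (y - y')"
  define R where "R t = (\<phi> (x + t *\<^sub>R y) - \<phi> x) + (\<phi> (x + t *\<^sub>R (- y')) - \<phi> x) - t * c" for t
  define f where "f t = t powr (-1 - 2 * s) * R t" for t
  have [measurable]: "R \<in> borel_measurable borel"
    using measurable_ray[of y] measurable_ray[of "-y'"] unfolding R_def[abs_def] by simp
  have R: "\<bar>R t\<bar> \<le> B * t\<^sup>2" if "0 < t" "t \<le> \<epsilon>" for t
  proof -
    have "\<bar>\<phi> (x + t *\<^sub>R y) - \<phi> x - g x \<bullet> (t *\<^sub>R y)\<bar> \<le> B / 2 * (norm (t *\<^sub>R y))\<^sup>2"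
      by (rule gradient_Taylor_bound[OF grad lip]) (use that assms in auto)
    moreover have "\<bar>\<phi> (x + t *\<^sub>R (- y')) - \<phi> x - g x \<bullet> (t *\<^sub>R (- y'))\<bar> \<le> B / 2 * (norm (t *\<^sub>R (- y')))\<^sup>2"
      by (rule gradient_Taylor_bound[OF grad lip]) (use that assms in auto)
    moreover have "R t = (\<phi> (x + t *\<^sub>R y) - \<phi> x - g x \<bullet> (t *\<^sub>R y)) + (\<phi> (x + t *\<^sub>R (- y')) - \<phi> x - g x \<bullet> (t *\<^sub>R (- y')))"
      unfolding R_def c_def by (simp add: inner_diff_right algebra_simps)
    moreover have "norm (t *\<^sub>R y) = t" "norm (t *\<^sub>R (- y')) = t" using that assms by auto
    ultimately show ?thesis by (smt (verit) field_sum_of_halves distrib_right)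
  qed
  have fb: "\<bar>f t\<bar> \<le> B * t powr (1 - 2 * s)" if "t \<in> {0<..\<epsilon>}" for t
  proof -
    have "\<bar>f t\<bar> \<le> t powr (-1 - 2 * s) * (B * t\<^sup>2)"
      unfolding f_def abs_mult using R[of t] that by (intro mult_mono) auto
    also have "t\<^sup>2 = t powr 2" using that by simp
    also have "t powr (-1 - 2 * s) * (B * t powr 2) = B * (t powr (-1 - 2 * s) * t powr 2)" by simp
    also have "t powr (-1 - 2 * s) * t powr 2 = t powr (1 - 2 * s)"
      by (simp flip: powr_add)
    finally show ?thesis .
  qed
  have hi: "set_integrable lborel {0<..\<epsilon>} (\<lambda>t. B * t powr (1 - 2 * s))"
    using s assms by (intro set_integrable_mult_right set_integrable_lborel_powr_head) auto
  have fi: "set_integrable lborel {0<..\<epsilon>} f"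
  proof (rule set_integrable_bound[OF hi])
    show "set_borel_measurable lborel {0<..\<epsilon>} f"
      unfolding set_borel_measurable_def f_def[abs_def] by measurable
    show "AE t in lborel. t \<in> {0<..\<epsilon>} \<longrightarrow> norm (f t) \<le> norm (B * t powr (1 - 2 * s))"
      using fb by (auto intro!: AE_I2 order_trans[OF _ abs_ge_self])
  qed
  define \<rho> where "\<rho> = (LINT t:{0<..\<epsilon>}|lborel. f t)"
  show thesis
  proof (rule that[of \<rho>])
    have "\<bar>\<rho>\<bar> \<le> (LINT t:{0<..\<epsilon>}|lborel. B * t powr (1 - 2 * s))"
      unfolding \<rho>_def by (rule abs_set_integral_le[OF fi hi fb])
    also have "\<dots> = B / 2 * \<epsilon> powr (2 - 2 * s) / (1 - s)"
      using s assms by (simp add: set_integrable_lborel_powr_head(2) field_simps)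
    finally show "\<bar>\<rho>\<bar> \<le> B / 2 * \<epsilon> powr (2 - 2 * s) / (1 - s)" .
    have eq: "(LINT t:{\<delta><..\<epsilon>}|lborel. f t) + (G \<epsilon> y + G \<epsilon> (- y')) =
       G \<delta> y + G \<delta> (- y') - c * ((\<delta> powr (1 - 2 * s) - \<epsilon> powr (1 - 2 * s)) / (2 * s - 1))"
      if \<delta>: "0 < \<delta>" "\<delta> < \<epsilon>" for \<delta>
    proof -
      let ?h = "\<lambda>y t. t powr (-1 - 2 * s) * (\<phi> (x + t *\<^sub>R y) - \<phi> x)"
      \<comment> \<open>Away from 0 the remainder may be split again into its three pieces, each
        integrable on (\<delta>, \<epsilon>].\<close>
      have "f t = ?h y t + ?h (- y') t - c * t powr (- 2 * s)" if "t \<in> {\<delta><..\<epsilon>}" for t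
      proof -
        have "t powr (- 2 * s) = t powr (-1 - 2 * s) * t"
          using that \<delta> powr_add[of t "-1 - 2 * s" 1] by simp
        then show ?thesis unfolding f_def R_def by (simp add: algebra_simps)
      qed
      then have "(LINT t:{\<delta><..\<epsilon>}|lborel. f t) =
          (LINT t:{\<delta><..\<epsilon>}|lborel. ?h y t + ?h (- y') t - c * t powr (- 2 * s))"
        by (intro set_lebesgue_integral_cong) auto
      also have "\<dots> = (LINT t:{\<delta><..\<epsilon>}|lborel. ?h y t) + (LINT t:{\<delta><..\<epsilon>}|lborel. ?h (- y') t)
          - c * (LINT t:{\<delta><..\<epsilon>}|lborel. t powr (- 2 * s))"
      proof -
        note i = G_split(2)[of \<delta> \<epsilon>, OF \<delta>(1) less_imp_le[OF \<delta>(2)]]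
        have j: "set_integrable lborel {\<delta><..\<epsilon>} (\<lambda>t. c * t powr (- 2 * s))"
          using s \<delta> by (intro set_integrable_mult_right set_integral_lborel_powr_Ioc(1)) auto
        show ?thesis
          unfolding set_integral_diff(2)[OF set_integral_add(1)[OF i i] j] set_integral_add(2)[OF i i]
          by simp
      qed
      also have "(LINT t:{\<delta><..\<epsilon>}|lborel. t powr (- 2 * s)) =
         (\<epsilon> powr (- 2 * s + 1) - \<delta> powr (- 2 * s + 1)) / (- 2 * s + 1)"
        using s \<delta> by (intro set_integral_lborel_powr_Ioc(2)) auto
      also have "\<dots> = (\<delta> powr (1 - 2 * s) - \<epsilon> powr (1 - 2 * s)) / (2 * s - 1)"
        using s by (simp add: field_simps)
      finally show ?thesis
        using G_split(1)[of \<delta> \<epsilon> y] G_split(1)[of \<delta> \<epsilon> "- y'"] \<delta> by simp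
    qed
    have "((\<lambda>\<delta>. (LINT t:{\<delta><..\<epsilon>}|lborel. f t) + (G \<epsilon> y + G \<epsilon> (- y'))) \<longlongrightarrow> \<rho> + (G \<epsilon> y + G \<epsilon> (- y'))) (at_right 0)"
      unfolding \<rho>_def by (intro tendsto_add tendsto_const tendsto_set_integral_Ioc_at_right fi assms)
    moreover have "eventually (\<lambda>\<delta>. (LINT t:{\<delta><..\<epsilon>}|lborel. f t) + (G \<epsilon> y + G \<epsilon> (- y')) =
       G \<delta> y + G \<delta> (- y') - c * ((\<delta> powr (1 - 2 * s) - \<epsilon> powr (1 - 2 * s)) / (2 * s - 1))) (at_right 0)"
      using eventually_at_right_real[OF assms(1)] by eventually_elim (use eq in auto)
    ultimately show "((\<lambda>\<delta>. G \<delta> y + G \<delta> (- y') - g x \<bullet> (y - y') * ((\<delta> powr (1 - 2 * s) - \<epsilon> powr (1 - 2 * s)) / (2 * s - 1)))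
       \<longlongrightarrow> G \<epsilon> y + G \<epsilon> (- y') + \<rho>) (at_right 0)"
      unfolding c_def[symmetric] by (subst add.commute) (rule Lim_transform_eventually)
  qed
qed

end

section \<open>Powers near zero, the one-dimensional sphere and \<open>kappa\<close>\<close>

lemma filterlim_powr_neg_at_right_0:
  fixes e :: real
  assumes "e < 0"
  shows "filterlim (\<lambda>\<delta>. \<delta> powr e) at_top (at_right 0)"
proof -
  have "((\<lambda>\<delta>::real. \<delta> powr (- e)) \<longlongrightarrow> 0) (at_right 0)"
    using assms by (intro tendsto_zero_powrI tendsto_ident_at tendsto_const)
      (auto simp: eventually_at_right_less eventually_mono[OF eventually_at_right_less])
  moreover have "eventually (\<lambda>\<delta>::real. 0 < \<delta> powr (- e)) (at_right 0)"
    using eventually_at_right_less[of "0::real"] by eventually_elim simp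
  ultimately have "filterlim (\<lambda>\<delta>::real. inverse (\<delta> powr (- e))) at_top (at_right 0)"
    by (rule filterlim_inverse_at_top)
  then show ?thesis by (simp add: powr_minus)
qed

lemma unit_vectors_dim1:
  fixes u v :: "'a::euclidean_space"
  assumes "DIM('a) = 1" "norm u = 1" "norm v = 1"
  shows "v = u \<or> v = - u"
proof -
  obtain b :: 'a where b: "Basis = {b}" using assms(1) by (auto simp: card_1_singleton_iff)
  have "z = (z \<bullet> b) *\<^sub>R b" for z :: 'a using euclidean_representation[of z] by (simp add: b)
  moreover have "norm b = 1" using b by (metis insertI1 norm_Basis)
  ultimately have "\<bar>z \<bullet> b\<bar> = 1" if "norm z = 1" for z :: 'a
    using that by (metis mult.right_neutral norm_scaleR)
  from this[OF assms(2)] this[OF assms(3)] have "v \<bullet> b = u \<bullet> b \<or> v \<bullet> b = - (u \<bullet> b)" by linarith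
  then show ?thesis
    using \<open>\<And>z. z = (z \<bullet> b) *\<^sub>R b\<close> by (metis scaleR_minus_left)
qed

lemma kappa_upper:
  assumes "0 \<le> a" "a \<le> 2"
    "a\<^sup>2 \<le> 8 * omega_phi \<phi> x \<eta> a / p *
      (((2* s - 1) / (2* s)) * \<eta> powr (-2* s) + \<eta> powr (1 - 2* s)) / (\<epsilon> powr (1 - 2* s) - \<eta> powr (1 - 2* s))"
  shows "a \<le> kappa s \<phi> x \<eta> p \<epsilon>"
  unfolding kappa_def by (rule cSup_upper) (use assms in \<open>auto intro!: bdd_aboveI[of _ 2]\<close>)

section \<open>The improper integral and the operator \<open>Ls\<close>\<close>

context taylor_point
begin

text \<open>\<open>Lim\<close> is a description operator, so its value is obtained by exhibiting a
  limit in the extended reals, where limits are unique.\<close>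

lemma int0_eqI:
  assumes "((\<lambda>\<delta>. ereal (C_s s * (G \<delta> y + G \<delta> (- y')))) \<longlongrightarrow> l) (at_right 0)"
  shows "int0 s \<phi> x y y' = l"
  unfolding int0_def
proof (rule tendsto_Lim)
  have "eventually (\<lambda>\<delta>. ereal (C_s s * (G \<delta> y + G \<delta> (- y'))) =
     ereal (LINT t:{\<delta><..}|mu_s s. Lphi \<phi> x (t *\<^sub>R y) (t *\<^sub>R y'))) (at_right 0)"
    using eventually_at_right_less[of "0::real"] by eventually_elim (simp add: integral_Lphi)
  with assms show "((\<lambda>\<delta>. ereal (LINT t:{\<delta><..}|mu_s s. Lphi \<phi> x (t *\<^sub>R y) (t *\<^sub>R y'))) \<longlongrightarrow> l) (at_right 0)"
    by (rule Lim_transform_eventually)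
qed simp

text \<open>The divergent term carries the factor \<open>g x \<bullet> (y - y')\<close>; when this
  vanishes, only the remainder survives the limit.\<close>

lemma int0_finite:
  assumes "0 < \<epsilon>" "\<epsilon> \<le> \<eta>" "norm y = 1" "norm y' = 1" "g x \<bullet> (y - y') = 0"
  obtains \<rho> where "\<bar>\<rho>\<bar> \<le> B / 2 * \<epsilon> powr (2 - 2 * s) / (1 - s)"
    "int0 s \<phi> x y y' = ereal (C_s s * (G \<epsilon> y + G \<epsilon> (- y') + \<rho>))"
proof -
  obtain \<rho> where \<rho>: "\<bar>\<rho>\<bar> \<le> B / 2 * \<epsilon> powr (2 - 2 * s) / (1 - s)"
    "((\<lambda>\<delta>. G \<delta> y + G \<delta> (- y') - g x \<bullet> (y - y') * ((\<delta> powr (1 - 2 * s) - \<epsilon> powr (1 - 2 * s)) / (2 * s - 1)))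
       \<longlongrightarrow> G \<epsilon> y + G \<epsilon> (- y') + \<rho>) (at_right 0)"
    by (rule G_limit[OF assms(1-4)])
  show thesis
  proof (rule that[OF \<rho>(1)], rule int0_eqI)
    show "((\<lambda>\<delta>. ereal (C_s s * (G \<delta> y + G \<delta> (- y')))) \<longlongrightarrow> ereal (C_s s * (G \<epsilon> y + G \<epsilon> (- y') + \<rho>))) (at_right 0)"
      using \<rho>(2) unfolding assms(5) by (intro tendsto_ereal tendsto_mult_left) simp
  qed
qed

text \<open>After subtraction of \<open>c * q \<delta>\<close> the expression converges, while q
  itself tends to infinity because 1 - 2 s < 0. The sign of c therefore decides.\<close>

lemma int0_infinite:
  assumes "norm y = 1" "norm y' = 1"
  shows "g x \<bullet> (y - y') > 0 \<Longrightarrow> int0 s \<phi> x y y' = \<infinity>"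
    and "g x \<bullet> (y - y') < 0 \<Longrightarrow> int0 s \<phi> x y y' = -\<infinity>"
proof -
  define c where "c = g x \<bullet> (y - y')"
  define q where "q \<delta> = (\<delta> powr (1 - 2 * s) - \<eta> powr (1 - 2 * s)) / (2 * s - 1)" for \<delta>
  obtain L where L: "((\<lambda>\<delta>. G \<delta> y + G \<delta> (- y') - c * q \<delta>) \<longlongrightarrow> L) (at_right 0)"
    unfolding c_def q_def by (rule G_limit[OF \<eta> order_refl assms])
  have "filterlim (\<lambda>\<delta>. (1 / (2 * s - 1)) * (- (\<eta> powr (1 - 2 * s)) + \<delta> powr (1 - 2 * s))) at_top (at_right 0)"
    using s by (intro filterlim_tendsto_pos_mult_at_top[OF tendsto_const]
      filterlim_tendsto_add_at_top[OF tendsto_const] filterlim_powr_neg_at_right_0) auto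
  then have q: "filterlim q at_top (at_right 0)" unfolding q_def[abs_def] by simp
  show "int0 s \<phi> x y y' = \<infinity>" if "g x \<bullet> (y - y') > 0"
  proof (rule int0_eqI, subst tendsto_PInfty_eq_at_top)
    have "filterlim (\<lambda>\<delta>. C_s s * ((G \<delta> y + G \<delta> (- y') - c * q \<delta>) + c * q \<delta>)) at_top (at_right 0)"
      using that C_s_pos[OF s] unfolding c_def[symmetric]
      by (intro filterlim_tendsto_pos_mult_at_top[OF tendsto_const]
        filterlim_tendsto_add_at_top[OF L] q) auto
    then show "filterlim (\<lambda>\<delta>. C_s s * (G \<delta> y + G \<delta> (- y'))) at_top (at_right 0)" by simp
  qed
  show "int0 s \<phi> x y y' = -\<infinity>" if "g x \<bullet> (y - y') < 0"
  proof (rule int0_eqI)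
    have "filterlim (\<lambda>\<delta>. C_s s * (- (G \<delta> y + G \<delta> (- y') - c * q \<delta>) + (- c) * q \<delta>)) at_top (at_right 0)"
      using that C_s_pos[OF s] unfolding c_def[symmetric]
      by (intro filterlim_tendsto_pos_mult_at_top[OF tendsto_const]
        filterlim_tendsto_add_at_top[OF tendsto_minus[OF L]] q) auto
    moreover have "(\<lambda>\<delta>. C_s s * (- (G \<delta> y + G \<delta> (- y') - c * q \<delta>) + (- c) * q \<delta>)) =
      (\<lambda>\<delta>. - (C_s s * (G \<delta> y + G \<delta> (- y'))))" by (simp add: algebra_simps)
    ultimately have "((\<lambda>\<delta>. ereal (- (C_s s * (G \<delta> y + G \<delta> (- y'))))) \<longlongrightarrow> \<infinity>) (at_right 0)"
      unfolding tendsto_PInfty_eq_at_top by simp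
    from tendsto_uminus_ereal[OF this]
    show "((\<lambda>\<delta>. ereal (C_s s * (G \<delta> y + G \<delta> (- y')))) \<longlongrightarrow> - \<infinity>) (at_right 0)" by simp
  qed
qed

text \<open>Without a gradient the integral is, within K uniformly, a function of y plus a function
  of - y'. The sphere is symmetric, so the sup-inf decouples into \<open>S + I\<close>.\<close>

lemma Ls_stationary:
  assumes "g x = 0" "0 < \<epsilon>" "\<epsilon> \<le> \<eta>"
  shows "\<bar>(SUP y\<in>sphere 0 1. G \<epsilon> y) + (INF y\<in>sphere 0 1. G \<epsilon> y) - Ls s \<phi> x / C_s s\<bar>
     \<le> B / 2 * \<epsilon> powr (2 - 2 * s) / (1 - s)"
proof -
  define K where "K = B / 2 * \<epsilon> powr (2 - 2 * s) / (1 - s)"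
  define S where "S = (SUP y\<in>sphere 0 1. G \<epsilon> y)"
  define I where "I = (INF y\<in>sphere 0 1. G \<epsilon> y)"
  define V where "V = (SUP y\<in>sphere 0 1. INF y'\<in>sphere 0 1. int0 s \<phi> x y y')"
  have C: "C_s s > 0" by (rule C_s_pos[OF s])
  obtain b where b: "\<And>y. \<bar>G \<epsilon> y\<bar> \<le> b" by (rule G_bounded[OF assms(2)]) blast
  have ba: "bdd_above (G \<epsilon> ` sphere 0 1)"
    by (rule bdd_aboveI[of _ b]) (use b in \<open>auto dest: abs_le_D1\<close>)
  have bb: "bdd_below (G \<epsilon> ` sphere 0 1)"
  proof -
    have "- b \<le> G \<epsilon> y" for y using b[of y] by linarith
    then show ?thesis by (auto intro!: bdd_belowI[of _ "-b"])
  qed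
  have ne: "sphere (0::'a) 1 \<noteq> {}" by simp
  have int0: "ereal (C_s s * (G \<epsilon> y + G \<epsilon> (- y') - K)) \<le> int0 s \<phi> x y y' \<and>
     int0 s \<phi> x y y' \<le> ereal (C_s s * (G \<epsilon> y + G \<epsilon> (- y') + K))" if y: "norm y = 1" "norm y' = 1" for y y'
  proof -
    obtain \<rho> where \<rho>: "\<bar>\<rho>\<bar> \<le> K" "int0 s \<phi> x y y' = ereal (C_s s * (G \<epsilon> y + G \<epsilon> (- y') + \<rho>))"
      unfolding K_def by (rule int0_finite[OF assms(2,3) y]) (use assms(1) in auto)
    show ?thesis using \<rho> C by (auto simp: abs_le_iff intro!: mult_left_mono)
  qed
  have up: "V \<le> ereal (C_s s * (S + I + K + e))" if "e > 0" for e
    unfolding V_def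
  proof (rule SUP_least)
    fix y :: 'a assume y: "y \<in> sphere 0 1"
    \<comment> \<open>A near-minimiser with slack e is used, so that attainment of the infimum is
      never at issue; the inner infimum is tested at its negative.\<close>
    have "I < I + e" using that by simp
    then obtain z where z: "z \<in> sphere 0 1" "G \<epsilon> z < I + e"
      unfolding I_def using cINF_less_iff[OF ne bb] by blast
    have "(INF y'\<in>sphere 0 1. int0 s \<phi> x y y') \<le> int0 s \<phi> x y (- z)"
      by (rule INF_lower) (use z in auto)
    also have "\<dots> \<le> ereal (C_s s * (G \<epsilon> y + G \<epsilon> (- (- z)) + K))" using int0[of y "- z"] y z by auto
    also have "\<dots> \<le> ereal (C_s s * (S + I + K + e))"
      using C z cSUP_upper[OF y ba] unfolding S_def by (auto intro!: mult_left_mono)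
    finally show "(INF y'\<in>sphere 0 1. int0 s \<phi> x y y') \<le> ereal (C_s s * (S + I + K + e))" .
  qed
  have lo: "ereal (C_s s * (S + I - K - e)) \<le> V" if "e > 0" for e
  proof -
    have "S - e < S" using that by simp
    then obtain y where y: "y \<in> sphere 0 1" "S - e < G \<epsilon> y"
      unfolding S_def using less_cSUP_iff[OF ne ba] by blast
    have "ereal (C_s s * (S + I - K - e)) \<le> (INF y'\<in>sphere 0 1. int0 s \<phi> x y y')"
    proof (rule INF_greatest)
      fix y' :: 'a assume y': "y' \<in> sphere 0 1"
      have "I \<le> G \<epsilon> (- y')" unfolding I_def using y' by (intro cINF_lower bb) auto
      then have "ereal (C_s s * (S + I - K - e)) \<le> ereal (C_s s * (G \<epsilon> y + G \<epsilon> (- y') - K))"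
        using C y by (auto intro!: mult_left_mono)
      also have "\<dots> \<le> int0 s \<phi> x y y'" using int0[of y y'] y y' by auto
      finally show "ereal (C_s s * (S + I - K - e)) \<le> int0 s \<phi> x y y'" .
    qed
    also have "\<dots> \<le> V" unfolding V_def by (rule SUP_upper[OF y(1)])
    finally show ?thesis .
  qed
  \<comment> \<open>The bounds with slack 1 exclude infinite values, so \<open>real_of_ereal\<close>
    returns the true value and not its default 0.\<close>
  obtain r where r: "V = ereal r" using up[of 1] lo[of 1] by (cases V) auto
  have "\<bar>S + I - r / C_s s\<bar> \<le> K + e" if "e > 0" for e
  proof -
    have "r / C_s s \<le> S + I + K + e" "S + I - K - e \<le> r / C_s s"
      using up[OF that] lo[OF that] C by (simp_all add: r field_simps)
    then show ?thesis by linarith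
  qed
  then have "\<bar>S + I - r / C_s s\<bar> \<le> K" by (rule field_le_epsilon)
  moreover have "Ls s \<phi> x = r" unfolding Ls_def V_def[symmetric] r by simp
  ultimately show ?thesis unfolding S_def I_def K_def by simp
qed

text \<open>By strict Cauchy-Schwarz u is the only unit vector maximising
  \<open>g x \<bullet> y\<close>. For y other than u the choice y' = u gives minus infinity; for y =
  u every other y' gives plus infinity. Both extrema thus single out the pair (u, u), where no
  divergent term is left.\<close>

lemma Ls_nonstationary:
  assumes p: "g x \<noteq> 0" and \<epsilon>: "0 < \<epsilon>" "\<epsilon> \<le> \<eta>"
  defines "u \<equiv> g x /\<^sub>R norm (g x)"
  shows "\<bar>G \<epsilon> u + G \<epsilon> (- u) - Ls s \<phi> x / C_s s\<bar> \<le> B / 2 * \<epsilon> powr (2 - 2 * s) / (1 - s)"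
proof -
  have u: "norm u = 1" "g x \<bullet> u = norm (g x)"
    unfolding u_def using p by (auto simp: dot_square_norm power2_eq_square field_simps)
  have less: "g x \<bullet> y < norm (g x)" if "norm y = 1" "y \<noteq> u" for y
  proof -
    have "g x \<bullet> y \<noteq> norm (g x)"
    proof
      assume "g x \<bullet> y = norm (g x)"
      then have "u \<bullet> y = 1" unfolding u_def using p by simp
      then have "norm (y - u) ^ 2 = 0"
        using u that unfolding power2_norm_eq_inner inner_diff_left inner_diff_right
        by (simp only: inner_commute[of y u] dot_square_norm) simp
      with that(2) show False by simp
    qed
    moreover have "g x \<bullet> y \<le> norm (g x)" using norm_cauchy_schwarz[of "g x" y] that by simp
    ultimately show ?thesis by simp
  qed
  obtain \<rho> where \<rho>: "\<bar>\<rho>\<bar> \<le> B / 2 * \<epsilon> powr (2 - 2 * s) / (1 - s)"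
    "int0 s \<phi> x u u = ereal (C_s s * (G \<epsilon> u + G \<epsilon> (- u) + \<rho>))"
    by (rule int0_finite[OF \<epsilon> u(1) u(1)]) auto
  have uin: "u \<in> sphere 0 1" using u by simp
  have inf_u: "(INF y'\<in>sphere 0 1. int0 s \<phi> x u y') = int0 s \<phi> x u u"
  proof (rule antisym)
    show "(INF y'\<in>sphere 0 1. int0 s \<phi> x u y') \<le> int0 s \<phi> x u u" by (rule INF_lower[OF uin])
    show "int0 s \<phi> x u u \<le> (INF y'\<in>sphere 0 1. int0 s \<phi> x u y')"
    proof (rule INF_greatest)
      fix y' :: 'a assume y': "y' \<in> sphere 0 1"
      show "int0 s \<phi> x u u \<le> int0 s \<phi> x u y'"
      proof (cases "y' = u")
        case False
        then have "int0 s \<phi> x u y' = \<infinity>"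
          using int0_infinite(1)[OF u(1), of y'] less[of y'] y' u by (simp add: inner_diff_right)
        then show ?thesis by simp
      qed simp
    qed
  qed
  have inf_other: "(INF y'\<in>sphere 0 1. int0 s \<phi> x y y') = -\<infinity>" if "y \<in> sphere 0 1" "y \<noteq> u" for y
  proof -
    have "int0 s \<phi> x y u = -\<infinity>"
      using int0_infinite(2)[of y u] less[of y] that u by (simp add: inner_diff_right)
    then show ?thesis using INF_lower[OF uin, of "int0 s \<phi> x y"] by simp
  qed
  have "(SUP y\<in>sphere 0 1. INF y'\<in>sphere 0 1. int0 s \<phi> x y y') = int0 s \<phi> x u u"
  proof (rule antisym)
    show "(SUP y\<in>sphere 0 1. INF y'\<in>sphere 0 1. int0 s \<phi> x y y') \<le> int0 s \<phi> x u u"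
    proof (rule SUP_least)
      fix y :: 'a assume "y \<in> sphere 0 1"
      then show "(INF y'\<in>sphere 0 1. int0 s \<phi> x y y') \<le> int0 s \<phi> x u u"
        by (cases "y = u") (simp_all add: inf_u inf_other)
    qed
    show "int0 s \<phi> x u u \<le> (SUP y\<in>sphere 0 1. INF y'\<in>sphere 0 1. int0 s \<phi> x y y')"
      by (subst inf_u[symmetric]) (rule SUP_upper[OF uin])
  qed
  then have "Ls s \<phi> x = C_s s * (G \<epsilon> u + G \<epsilon> (- u) + \<rho>)" unfolding Ls_def \<rho>(2) by simp
  then have "Ls s \<phi> x / C_s s = G \<epsilon> u + G \<epsilon> (- u) + \<rho>" using C_s_pos[OF s] by simp
  then show ?thesis using \<rho>(1) by simp
qed

section \<open>Comparison with the gradient direction\<close>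

text \<open>The integral is split at t = \<eta>. On (\<epsilon>, \<eta>] the first-order term
  integrates exactly and the error per radius is B t^2 |u - v|. Beyond \<eta> the chain along the
  sphere gives a factor 2 + 2 t, still integrable against the weight because 2 s > 1.\<close>

lemma G_difference:
  assumes dim: "2 \<le> DIM('a)" and uv: "norm u = 1" "norm v = 1" and \<epsilon>: "0 < \<epsilon>" "\<epsilon> \<le> \<eta>"
  shows "\<bar>G \<epsilon> u - G \<epsilon> v - g x \<bullet> (u - v) * ((\<epsilon> powr (1 - 2 * s) - \<eta> powr (1 - 2 * s)) / (2 * s - 1))\<bar>
    \<le> B * norm (u - v) * ((\<eta> powr (2 - 2 * s) - \<epsilon> powr (2 - 2 * s)) / (2 - 2 * s))
      + 2 * (\<eta> powr (- 2 * s) / (2 * s) + \<eta> powr (1 - 2 * s) / (2 * s - 1)) * omega_phi \<phi> x \<eta> (norm (u - v))"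
proof -
  define a where "a = norm (u - v)"
  define c where "c = g x \<bullet> (u - v)"
  define m where "m = omega_phi \<phi> x \<eta> a"
  have m: "m \<ge> 0" unfolding m_def a_def by (rule omega_phi_nonneg[OF bdd]) simp
  let ?h = "\<lambda>y t. t powr (-1 - 2 * s) * (\<phi> (x + t *\<^sub>R y) - \<phi> x)"
  note hi = G_split(2)[OF \<epsilon>] and ti = set_integrable_G[OF \<eta>]
  have ci: "set_integrable lborel {\<epsilon><..\<eta>} (\<lambda>t. c * t powr (- 2 * s))"
    using s \<epsilon> by (intro set_integrable_mult_right set_integral_lborel_powr_Ioc(1)) auto
  have Bi: "set_integrable lborel {\<epsilon><..\<eta>} (\<lambda>t. B * a * t powr (1 - 2 * s))"
    using s \<epsilon> by (intro set_integrable_mult_right set_integral_lborel_powr_Ioc(1)) auto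
  have cint: "(LINT t:{\<epsilon><..\<eta>}|lborel. c * t powr (- 2 * s)) = c * ((\<epsilon> powr (1 - 2 * s) - \<eta> powr (1 - 2 * s)) / (2 * s - 1))"
  proof -
    have "(LINT t:{\<epsilon><..\<eta>}|lborel. t powr (- 2 * s)) = (\<eta> powr (- 2 * s + 1) - \<epsilon> powr (- 2 * s + 1)) / (- 2 * s + 1)"
      using s \<epsilon> by (intro set_integral_lborel_powr_Ioc(2)) auto
    also have "\<dots> = (\<epsilon> powr (1 - 2 * s) - \<eta> powr (1 - 2 * s)) / (2 * s - 1)"
      using s by (simp add: field_simps)
    finally show ?thesis by simp
  qed
  have inner: "\<bar>(LINT t:{\<epsilon><..\<eta>}|lborel. ?h u t) - (LINT t:{\<epsilon><..\<eta>}|lborel. ?h v t) - (LINT t:{\<epsilon><..\<eta>}|lborel. c * t powr (- 2 * s))\<bar>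
     \<le> (LINT t:{\<epsilon><..\<eta>}|lborel. B * a * t powr (1 - 2 * s))"
    unfolding set_integral_diff(2)[OF hi hi, symmetric]
      set_integral_diff(2)[OF set_integral_diff(1)[OF hi hi] ci, symmetric]
  proof (rule abs_set_integral_le[OF set_integral_diff(1)[OF set_integral_diff(1)[OF hi hi] ci] Bi])
    fix t assume t: "t \<in> {\<epsilon><..\<eta>}"
    then have t0: "0 < t" "t \<le> \<eta>" using \<epsilon> by auto
    have e1: "t powr (- 2 * s) = t powr (-1 - 2 * s) * t"
      using t0 powr_add[of t "-1 - 2 * s" 1] by simp
    have e2: "t powr (1 - 2 * s) = t powr (-1 - 2 * s) * t\<^sup>2"
      using t0 powr_add[of t "-1 - 2 * s" 2] by simp
    have "\<bar>\<phi> (x + t *\<^sub>R u) - \<phi> (x + t *\<^sub>R v) - g x \<bullet> (t *\<^sub>R u - t *\<^sub>R v)\<bar> \<le> B * t * norm (t *\<^sub>R u - t *\<^sub>R v)"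
      by (rule gradient_increment_bound[OF grad lip B]) (use t0 uv in auto)
    then have "\<bar>\<phi> (x + t *\<^sub>R u) - \<phi> (x + t *\<^sub>R v) - t * c\<bar> \<le> B * a * t\<^sup>2"
      unfolding scaleR_diff_right[symmetric] inner_scaleR_right norm_scaleR a_def c_def
      using t0 by (simp add: power2_eq_square mult_ac)
    then have "t powr (-1 - 2 * s) * \<bar>\<phi> (x + t *\<^sub>R u) - \<phi> (x + t *\<^sub>R v) - t * c\<bar> \<le> t powr (-1 - 2 * s) * (B * a * t\<^sup>2)"
      by (intro mult_left_mono) auto
    moreover have "?h u t - ?h v t - c * t powr (- 2 * s) =
        t powr (-1 - 2 * s) * (\<phi> (x + t *\<^sub>R u) - \<phi> (x + t *\<^sub>R v) - t * c)"
      unfolding e1 by (simp add: algebra_simps)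
    ultimately show "\<bar>?h u t - ?h v t - c * t powr (- 2 * s)\<bar> \<le> B * a * t powr (1 - 2 * s)"
      unfolding e2 by (simp add: abs_mult mult_ac)
  qed
  have Bint: "(LINT t:{\<epsilon><..\<eta>}|lborel. B * a * t powr (1 - 2 * s)) =
     B * a * ((\<eta> powr (2 - 2 * s) - \<epsilon> powr (2 - 2 * s)) / (2 - 2 * s))"
    using s \<epsilon> by (simp add: set_integral_lborel_powr_Ioc(2))
  have i1: "set_integrable lborel {\<eta><..} (\<lambda>t. 2 * m * t powr (-1 - 2 * s))"
    using s \<eta> by (intro set_integrable_mult_right set_integrable_lborel_powr_tail) auto
  have i2: "set_integrable lborel {\<eta><..} (\<lambda>t. 2 * m * t powr (- 2 * s))"
    using s \<eta> by (intro set_integrable_mult_right set_integrable_lborel_powr_tail) auto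
  have outer: "\<bar>G \<eta> u - G \<eta> v\<bar> \<le> (LINT t:{\<eta><..}|lborel. 2 * m * t powr (-1 - 2 * s) + 2 * m * t powr (- 2 * s))"
    unfolding G_def set_integral_diff(2)[OF ti ti, symmetric]
  proof (rule abs_set_integral_le[OF set_integral_diff(1)[OF ti ti] set_integral_add(1)[OF i1 i2]])
    fix t assume t: "t \<in> {\<eta><..}"
    then have t0: "0 < t" using \<eta> by auto
    have e1: "t powr (- 2 * s) = t powr (-1 - 2 * s) * t"
      using t0 powr_add[of t "-1 - 2 * s" 1] by simp
    \<comment> \<open>At radius t > \<eta> the whole chain stays outside the closed ball. The
      modulus is taken at |u - v| and not at t |u - v|, for which the linear factor pays.\<close>
    have "\<bar>\<phi> (x + t *\<^sub>R u) - \<phi> (x + t *\<^sub>R v)\<bar> \<le> (2 + 2 * t) * m"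
      by (rule sphere_chain_bound[OF dim uv t0 _ m])
        (use t in \<open>auto simp: m_def a_def intro!: omega_phi_upper[OF bdd]\<close>)
    then have "t powr (-1 - 2 * s) * \<bar>\<phi> (x + t *\<^sub>R u) - \<phi> (x + t *\<^sub>R v)\<bar> \<le> t powr (-1 - 2 * s) * ((2 + 2 * t) * m)"
      by (intro mult_left_mono) auto
    moreover have "?h u t - ?h v t = t powr (-1 - 2 * s) * (\<phi> (x + t *\<^sub>R u) - \<phi> (x + t *\<^sub>R v))"
      by (simp add: algebra_simps)
    ultimately have "\<bar>?h u t - ?h v t\<bar> \<le> t powr (-1 - 2 * s) * ((2 + 2 * t) * m)"
      by (simp only: abs_mult abs_of_nonneg[OF powr_ge_zero])
    then show "\<bar>?h u t - ?h v t\<bar> \<le> 2 * m * t powr (-1 - 2 * s) + 2 * m * t powr (- 2 * s)"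
      unfolding e1 by (simp only: algebra_simps)
  qed
  have "(LINT t:{\<eta><..}|lborel. 2 * m * t powr (-1 - 2 * s) + 2 * m * t powr (- 2 * s)) =
     2 * m * (LINT t:{\<eta><..}|lborel. t powr (-1 - 2 * s)) + 2 * m * (LINT t:{\<eta><..}|lborel. t powr (- 2 * s))"
    by (subst set_integral_add(2)[OF i1 i2]) simp
  also have "(LINT t:{\<eta><..}|lborel. t powr (-1 - 2 * s)) = \<eta> powr (- 2 * s) / (2 * s)"
    using s \<eta> by (simp add: set_integrable_lborel_powr_tail(2))
  also have "(LINT t:{\<eta><..}|lborel. t powr (- 2 * s)) = - (\<eta> powr (- 2 * s + 1)) / (- 2 * s + 1)"
    using s \<eta> by (intro set_integrable_lborel_powr_tail(2)) auto
  also have "\<dots> = \<eta> powr (1 - 2 * s) / (2 * s - 1)" using s by (simp add: field_simps)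
  finally have oint: "(LINT t:{\<eta><..}|lborel. 2 * m * t powr (-1 - 2 * s) + 2 * m * t powr (- 2 * s)) =
     2 * (\<eta> powr (- 2 * s) / (2 * s) + \<eta> powr (1 - 2 * s) / (2 * s - 1)) * m"
    by (simp add: algebra_simps)
  show ?thesis
    using inner outer G_split(1)[OF \<epsilon>, of u] G_split(1)[OF \<epsilon>, of v]
    unfolding cint Bint oint unfolding m_def a_def c_def by linarith
qed

text \<open>A direction at distance \<open>a\<close> from the gradient direction loses a quadratic amount in the
  singular part, so beating the gradient direction forces \<open>a\<close> to be at most \<open>A_eps\<close>.\<close>

lemma deviation_bound:
  fixes X a \<epsilon> p :: real
  defines "A \<equiv> A_eps s \<phi> x \<eta> p (B / 2) \<epsilon>"
    and "D1 \<equiv> (\<epsilon> powr (1 - 2 * s) - \<eta> powr (1 - 2 * s)) / (2 * s - 1)"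
    and "D2 \<equiv> (\<eta> powr (2 - 2 * s) - \<epsilon> powr (2 - 2 * s)) / (2 - 2 * s)"
    and "D3 \<equiv> \<eta> powr (- 2 * s) / (2 * s) + \<eta> powr (1 - 2 * s) / (2 * s - 1)"
  assumes \<epsilon>: "0 < \<epsilon>" "\<epsilon> < \<eta>" and p: "p > 0"
  shows "0 \<le> A" "0 \<le> D2" "0 \<le> D3"
    and "0 \<le> a \<Longrightarrow> a \<le> 2 \<Longrightarrow> X \<le> - (p * a\<^sup>2 / 2) * D1 + B * a * D2 + 2 * D3 * omega_phi \<phi> x \<eta> a \<Longrightarrow>
      X \<le> B * A * D2 + 2 * D3 * omega_phi \<phi> x \<eta> A"
proof -
  have "\<eta> powr (1 - 2 * s) < \<epsilon> powr (1 - 2 * s)"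
    using powr_less_mono2_neg[of "1 - 2 * s" \<epsilon> \<eta>] s \<epsilon> by simp
  then have d1: "D1 > 0" unfolding D1_def using s by simp
  have "\<epsilon> powr (2 - 2 * s) \<le> \<eta> powr (2 - 2 * s)" using s \<epsilon> by (intro powr_mono2) auto
  then show d2: "0 \<le> D2" unfolding D2_def using s by simp
  show d3: "0 \<le> D3" unfolding D3_def using s by simp
  \<comment> \<open>With C_x = B / 2, this equation and \<open>k\<close> express the two entries of
    \<open>A_eps\<close> through \<open>D1\<close>, \<open>D2\<close> and \<open>D3\<close>.\<close>
  have A1: "16 * (B / 2) / p * ((2* s - 1) / (1 - s)) * (\<eta> powr (2 - 2* s) - \<epsilon> powr (2 - 2* s)) / (\<epsilon> powr (1 - 2* s) - \<eta> powr (1 - 2* s))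
     = 16 * B * D2 / (p * D1)"
    unfolding D1_def D2_def using s p by (simp add: divide_simps)
  have k: "8 * omega_phi \<phi> x \<eta> a / p *
      (((2* s - 1) / (2* s)) * \<eta> powr (-2* s) + \<eta> powr (1 - 2* s)) / (\<epsilon> powr (1 - 2* s) - \<eta> powr (1 - 2* s))
     = 8 * omega_phi \<phi> x \<eta> a * D3 / (p * D1)" for a
  proof -
    have "((2* s - 1) / (2* s)) * \<eta> powr (-2* s) + \<eta> powr (1 - 2* s) = (2 * s - 1) * D3"
      unfolding D3_def using s by (simp add: field_simps)
    moreover have "\<epsilon> powr (1 - 2* s) - \<eta> powr (1 - 2* s) = (2 * s - 1) * D1"
      unfolding D1_def using s by simp
    ultimately show ?thesis using s by simp
  qed
  have A_first: "16 * B * D2 / (p * D1) \<le> A"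
    unfolding A_def A_eps_def A1 by simp
  have A_kappa: "kappa s \<phi> x \<eta> p \<epsilon> \<le> A"
    unfolding A_def A_eps_def by simp
  have "0 \<le> 16 * B * D2 / (p * D1)" using B d1 d2 p by simp
  then show A0: "0 \<le> A" using A_first by linarith
  assume a: "0 \<le> a" "a \<le> 2" and X: "X \<le> - (p * a\<^sup>2 / 2) * D1 + B * a * D2 + 2 * D3 * omega_phi \<phi> x \<eta> a"
  have \<omega>: "0 \<le> omega_phi \<phi> x \<eta> b" if "0 \<le> b" for b by (rule omega_phi_nonneg[OF bdd that])
  show "X \<le> B * A * D2 + 2 * D3 * omega_phi \<phi> x \<eta> A"
  proof (cases "X \<le> 0")
    case True
    also have "0 \<le> B * A * D2 + 2 * D3 * omega_phi \<phi> x \<eta> A"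
      using A0 B d2 d3 \<omega>[OF A0] by simp
    finally show ?thesis .
  next
    case False
    have pD: "p * D1 > 0" using p d1 by simp
    \<comment> \<open>If X is positive, the quadratic loss is below the sum of the two gains, so
      half of it is bounded by one of them. The first alternative leads to the explicit entry of
      \<open>A_eps\<close>, with a factor 4 to spare; the second is exactly the inequality defining
      \<open>kappa\<close>.\<close>
    have "p * D1 * a\<^sup>2 / 4 \<le> B * a * D2 \<or> p * D1 * a\<^sup>2 / 4 \<le> 2 * D3 * omega_phi \<phi> x \<eta> a"
      using False X by (simp add: algebra_simps) linarith
    then have "a \<le> A"
    proof
      assume 1: "p * D1 * a\<^sup>2 / 4 \<le> B * a * D2"
      show ?thesis
      proof (cases "a = 0")
        case False
        then have "a > 0" using a by simp
        with 1 have "p * D1 * a \<le> 4 * (B * D2)"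
          by (simp add: power2_eq_square field_simps)
        also have "\<dots> \<le> 16 * B * D2" using B d2 by simp
        finally have "a \<le> 16 * B * D2 / (p * D1)" using pD by (simp add: field_simps)
        then show ?thesis using A_first by linarith
      qed (use A0 in simp)
    next
      assume "p * D1 * a\<^sup>2 / 4 \<le> 2 * D3 * omega_phi \<phi> x \<eta> a"
      then have "a\<^sup>2 \<le> 8 * omega_phi \<phi> x \<eta> a * D3 / (p * D1)"
        using pD by (simp add: field_simps)
      then have "a \<le> kappa s \<phi> x \<eta> p \<epsilon>"
        by (intro kappa_upper a) (simp only: k)
      then show ?thesis using A_kappa by linarith
    qed
    \<comment> \<open>Once \<open>a \<le> A\<close> is known, the loss is dropped and the gains are
      monotone in a.\<close>
    have "X \<le> B * a * D2 + 2 * D3 * omega_phi \<phi> x \<eta> a"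
    proof -
      have "0 \<le> p * a\<^sup>2 / 2 * D1" using p d1 by simp
      with X show ?thesis by linarith
    qed
    also have "\<dots> \<le> B * A * D2 + 2 * D3 * omega_phi \<phi> x \<eta> A"
      using \<open>a \<le> A\<close> a B d2 d3 omega_phi_mono[OF bdd a(1) \<open>a \<le> A\<close>]
      by (intro add_mono mult_left_mono mult_right_mono) auto
    finally show ?thesis .
  qed
qed

text \<open>Between unit vectors |y - u|^2 = 2 - 2 (u \<bullet> y), so leaving the gradient
  direction costs an exactly quadratic amount.\<close>

lemma inner_gradient_direction:
  assumes "g x \<noteq> 0" "norm y = 1"
  defines "u \<equiv> g x /\<^sub>R norm (g x)"
  shows "g x \<bullet> (y - u) = - (norm (g x) * (norm (y - u))\<^sup>2 / 2)"
proof -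
  have u: "u \<bullet> u = 1" "g x = norm (g x) *\<^sub>R u"
    unfolding u_def using assms(1) by (auto simp: dot_square_norm power2_eq_square)
  have y: "y \<bullet> y = 1" using assms(2) by (simp add: dot_square_norm)
  have n: "(norm (y - u))\<^sup>2 = 2 - 2 * (u \<bullet> y)"
    unfolding power2_norm_eq_inner inner_diff_left inner_diff_right inner_commute[of y u] u(1) y by simp
  have e: "g x \<bullet> (y - u) = norm (g x) * (u \<bullet> y - 1)"
    by (subst u(2)) (simp add: inner_diff_right u(1) right_diff_distrib)
  show ?thesis unfolding n e by (simp add: field_simps)
qed

lemma SUP_INF_near_gradient:
  assumes p: "g x \<noteq> 0" and \<epsilon>: "0 < \<epsilon>" "\<epsilon> < \<eta>"
  defines "u \<equiv> g x /\<^sub>R norm (g x)"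
    and "A \<equiv> A_eps s \<phi> x \<eta> (norm (g x)) (B / 2) \<epsilon>"
    and "D2 \<equiv> (\<eta> powr (2 - 2 * s) - \<epsilon> powr (2 - 2 * s)) / (2 - 2 * s)"
    and "D3 \<equiv> \<eta> powr (- 2 * s) / (2 * s) + \<eta> powr (1 - 2 * s) / (2 * s - 1)"
  shows "\<bar>(SUP y\<in>sphere 0 1. G \<epsilon> y) + (INF y\<in>sphere 0 1. G \<epsilon> y) - (G \<epsilon> u + G \<epsilon> (- u))\<bar>
    \<le> B * A * D2 + 2 * D3 * omega_phi \<phi> x \<eta> A"
proof -
  define E where "E = B * A * D2 + 2 * D3 * omega_phi \<phi> x \<eta> A"
  define D1 where "D1 = (\<epsilon> powr (1 - 2 * s) - \<eta> powr (1 - 2 * s)) / (2 * s - 1)"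
  have pn: "norm (g x) > 0" using p by simp
  note dev = deviation_bound[OF \<epsilon> pn, folded A_def D1_def D2_def D3_def, folded E_def]
  have u: "norm u = 1" unfolding u_def using p by simp
  have ne: "sphere (0::'a) 1 \<noteq> {}" by simp
  have uin: "u \<in> sphere 0 1" "- u \<in> sphere 0 1" using u by auto
  obtain b where b: "\<And>y. \<bar>G \<epsilon> y\<bar> \<le> b" by (rule G_bounded[OF \<epsilon>(1)]) blast
  have "G \<epsilon> y \<le> b" "- b \<le> G \<epsilon> y" for y using b[of y] by linarith+
  then have bdds: "bdd_above (G \<epsilon> ` sphere 0 1)" "bdd_below (G \<epsilon> ` sphere 0 1)"
    by (auto intro!: bdd_aboveI[of _ b] bdd_belowI[of _ "-b"])
  have E0: "0 \<le> E"
    unfolding E_def using dev(1-3) B omega_phi_nonneg[OF bdd dev(1)] by simp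
  consider "DIM('a) = 1" | "2 \<le> DIM('a)" using DIM_positive[where 'a='a] by linarith
  then have "\<bar>(SUP y\<in>sphere 0 1. G \<epsilon> y) + (INF y\<in>sphere 0 1. G \<epsilon> y) - (G \<epsilon> u + G \<epsilon> (- u))\<bar> \<le> E"
  proof cases
    case 1
    have "y = u \<or> y = - u" if "y \<in> sphere 0 1" for y
      by (rule unit_vectors_dim1[OF 1 u]) (use that in simp)
    then have "sphere 0 1 = {u, - u}" using uin by blast
    \<comment> \<open>Maximum plus minimum of two numbers is their sum, so the difference to be
      bounded is zero.\<close>
    then have "(SUP y\<in>sphere 0 1. G \<epsilon> y) = max (G \<epsilon> u) (G \<epsilon> (- u))"
      "(INF y\<in>sphere 0 1. G \<epsilon> y) = min (G \<epsilon> u) (G \<epsilon> (- u))"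
      by (auto simp: cSup_eq_Max cInf_eq_Min)
    then show ?thesis using E0 by simp
  next
    case 2
    have n2: "norm (y - v) \<le> 2" if "norm y = 1" "norm v = 1" for y v :: 'a
      using norm_triangle_ineq4[of y v] that by simp
    have up: "G \<epsilon> y - G \<epsilon> u \<le> E" if y: "norm y = 1" for y
    proof (rule dev(4)[OF norm_ge_zero n2[OF y u]])
      show "G \<epsilon> y - G \<epsilon> u \<le> - (norm (g x) * (norm (y - u))\<^sup>2 / 2) * D1 + B * norm (y - u) * D2
          + 2 * D3 * omega_phi \<phi> x \<eta> (norm (y - u))"
        using G_difference[OF 2 y u \<epsilon>(1) less_imp_le[OF \<epsilon>(2)], folded D1_def D2_def D3_def]
        unfolding inner_gradient_direction[OF p y, folded u_def] by linarith
    qed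
    \<comment> \<open>Reflection: - y deviates from u as much as - u deviates from y, so the same
      quadratic loss applies at the minimum.\<close>
    have lo: "G \<epsilon> (- u) - G \<epsilon> y \<le> E" if y: "norm y = 1" for y
    proof -
      have u': "norm (- u) = 1" and y': "norm (- y) = 1" using u y by auto
      have nn: "norm (- y - u) = norm (- u - y)" by (metis minus_diff_commute)
      have "g x \<bullet> (- u - y) = - (norm (g x) * (norm (- u - y))\<^sup>2 / 2)"
        using inner_gradient_direction[OF p y', folded u_def] unfolding nn by (metis minus_diff_commute)
      then show ?thesis
        using G_difference[OF 2 u' y \<epsilon>(1) less_imp_le[OF \<epsilon>(2)], folded D1_def D2_def D3_def]
        by (intro dev(4)[OF norm_ge_zero n2[OF u' y]]) simp
    qed
    have "(SUP y\<in>sphere 0 1. G \<epsilon> y) \<le> G \<epsilon> u + E"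
      by (rule cSUP_least[OF ne]) (use up in \<open>auto simp: algebra_simps\<close>)
    moreover have "G \<epsilon> u \<le> (SUP y\<in>sphere 0 1. G \<epsilon> y)" by (rule cSUP_upper[OF uin(1) bdds(1)])
    moreover have "G \<epsilon> (- u) - E \<le> (INF y\<in>sphere 0 1. G \<epsilon> y)"
      by (rule cINF_greatest[OF ne]) (use lo in \<open>auto simp: algebra_simps\<close>)
    moreover have "(INF y\<in>sphere 0 1. G \<epsilon> y) \<le> G \<epsilon> (- u)" by (rule cINF_lower[OF bdds(2) uin(2)])
    \<comment> \<open>The two errors lie in [0, E] and in [-E, 0], so their sum is at most E in
      absolute value instead of 2 E.\<close>
    ultimately show ?thesis by linarith
  qed
  then show ?thesis unfolding E_def .
qed

section \<open>The expansion of the average\<close>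

lemma average_expansion:
  assumes \<epsilon>: "0 < \<epsilon>" "\<epsilon> < \<eta>"
  shows "\<bar>Ao s \<epsilon> \<phi> x - \<phi> x - 1 / (c_s s * (1 - s)) * \<epsilon> powr (2 * s) * Ls s \<phi> x\<bar>
      \<le> s / (1 - s) * (B / 2) * \<epsilon>\<^sup>2 + E_eps s \<phi> x \<eta> (g x) (B / 2) \<epsilon>"
proof -
  define S where "S = (SUP y\<in>sphere 0 1. G \<epsilon> y) + (INF y\<in>sphere 0 1. G \<epsilon> y)"
  define w where "w = s * \<epsilon> powr (2 * s)"
  have w: "w > 0" unfolding w_def using s \<epsilon> by simp
  have C: "C_s s > 0" by (rule C_s_pos[OF s])
  \<comment> \<open>The normalisation gives c_s (1 - s) = C_s / s, so both terms share the factor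
    \<open>w\<close>.\<close>
  have "Ao s \<epsilon> \<phi> x - \<phi> x - 1 / (c_s s * (1 - s)) * \<epsilon> powr (2 * s) * Ls s \<phi> x = w * (S - Ls s \<phi> x / C_s s)"
    unfolding Ao_eq[OF \<epsilon>(1)] S_def[symmetric] w_def c_s_def using s C by (simp add: field_simps)
  then have lhs: "\<bar>Ao s \<epsilon> \<phi> x - \<phi> x - 1 / (c_s s * (1 - s)) * \<epsilon> powr (2 * s) * Ls s \<phi> x\<bar> = w * \<bar>S - Ls s \<phi> x / C_s s\<bar>"
    using w by (simp add: abs_mult)
  have "\<epsilon> powr (2 * s) * \<epsilon> powr (2 - 2 * s) = \<epsilon>\<^sup>2" using \<epsilon> by (simp flip: powr_add)
  then have first: "w * (B / 2 * \<epsilon> powr (2 - 2 * s) / (1 - s)) = s / (1 - s) * (B / 2) * \<epsilon>\<^sup>2"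
    unfolding w_def by (simp add: field_simps)
  show ?thesis
  proof (cases "g x = 0")
    case True
    have "w * \<bar>S - Ls s \<phi> x / C_s s\<bar> \<le> w * (B / 2 * \<epsilon> powr (2 - 2 * s) / (1 - s))"
      unfolding S_def using w Ls_stationary[OF True \<epsilon>(1)] \<epsilon> by (intro mult_left_mono) auto
    then show ?thesis unfolding lhs first by (simp add: True E_eps_def)
  next
    case False
    define A where "A = A_eps s \<phi> x \<eta> (norm (g x)) (B / 2) \<epsilon>"
    define D2 where "D2 = (\<eta> powr (2 - 2 * s) - \<epsilon> powr (2 - 2 * s)) / (2 - 2 * s)"
    define D3 where "D3 = \<eta> powr (- 2 * s) / (2 * s) + \<eta> powr (1 - 2 * s) / (2 * s - 1)"
    have pn: "norm (g x) > 0" using False by simp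
    have nn: "0 \<le> A" "0 \<le> D2"
      using deviation_bound(1,2)[OF \<epsilon> pn] unfolding A_def D2_def by auto
    \<comment> \<open>In units of \<open>w\<close>, \<open>E_eps\<close> allows four times the
      interior error, while its coefficient of the modulus is exactly the one obtained.\<close>
    have "4 * s * (B / 2) * (\<eta> powr (2 - 2* s) - \<epsilon> powr (2 - 2* s)) / (1 - s) = s * (4 * B * D2)"
      unfolding D2_def using s by (simp add: field_simps)
    moreover have "\<eta> powr (-2* s) + (2* s) / (2* s - 1) * \<eta> powr (1 - 2* s) = s * (2 * D3)"
      unfolding D3_def using s by (simp add: field_simps)
    ultimately have E: "E_eps s \<phi> x \<eta> (g x) (B / 2) \<epsilon> = w * (4 * (B * A * D2) + 2 * D3 * omega_phi \<phi> x \<eta> A)"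
      unfolding E_eps_def A_def[symmetric] w_def using False by (simp add: algebra_simps)
    have "\<bar>S - Ls s \<phi> x / C_s s\<bar> \<le> B / 2 * \<epsilon> powr (2 - 2 * s) / (1 - s) + (B * A * D2 + 2 * D3 * omega_phi \<phi> x \<eta> A)"
      using SUP_INF_near_gradient[OF False \<epsilon>, folded A_def D2_def D3_def S_def]
        Ls_nonstationary[OF False \<epsilon>(1) less_imp_le[OF \<epsilon>(2)]] by linarith
    also have "\<dots> \<le> B / 2 * \<epsilon> powr (2 - 2 * s) / (1 - s) + (4 * (B * A * D2) + 2 * D3 * omega_phi \<phi> x \<eta> A)"
      using B nn by simp
    finally have "w * \<bar>S - Ls s \<phi> x / C_s s\<bar> \<le>
       w * (B / 2 * \<epsilon> powr (2 - 2 * s) / (1 - s) + (4 * (B * A * D2) + 2 * D3 * omega_phi \<phi> x \<eta> A))"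
      using w by (intro mult_left_mono) auto
    then show ?thesis unfolding lhs E distrib_left first by simp
  qed
qed

end

theorem theorem1p1:
  fixes s \<eta> :: real and x :: "'a::euclidean_space" and \<phi> :: "'a \<Rightarrow> real"
    and g :: "'a \<Rightarrow> 'a" and H :: "'a \<Rightarrow> 'a \<Rightarrow> 'a"
  assumes s: "1/2 < s" "s < 1"
    and \<eta>: "\<eta> > 0"
    and bdd: "bounded (range \<phi>)"
    and borel: "\<phi> \<in> borel_measurable borel"
    and grad: "\<And>z. z \<in> cball x \<eta> \<Longrightarrow> (\<phi> has_derivative (\<lambda>h. g z \<bullet> h)) (at z within cball x \<eta>)"
    and hess: "\<And>z. z \<in> cball x \<eta> \<Longrightarrow> (g has_derivative H z) (at z within cball x \<eta>)"
    and hess_cont: "\<And>v. continuous_on (cball x \<eta>) (\<lambda>z. H z v)"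
    and ucont: "uniformly_continuous_on (- cball x \<eta>) \<phi>"
    and eps: "0 < \<epsilon>" "\<epsilon> < \<eta>"
  shows "let p = g x; Cx = (1/2) * (SUP z\<in>ball x \<eta>. onorm (H z)) in
    \<bar>Ao s \<epsilon> \<phi> x - \<phi> x - 1 / (c_s s * (1 - s)) * \<epsilon> powr (2* s) * Ls s \<phi> x\<bar>
      \<le> s / (1 - s) * Cx * \<epsilon>\<^sup>2 + E_eps s \<phi> x \<eta> p Cx \<epsilon>"
proof -
  define B where "B = (SUP z\<in>ball x \<eta>. onorm (H z))"
  have lin: "bounded_linear (H z)" if "z \<in> cball x \<eta>" for z
    using hess[OF that] by (rule has_derivative_bounded_linear)
  have bound: "onorm (H z) \<le> B" if "z \<in> cball x \<eta>" for z
    unfolding B_def by (rule onorm_Sup_bound_on_cball[OF \<eta> lin hess_cont that])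
  have xin: "x \<in> cball x \<eta>" using \<eta> by simp
  have "0 \<le> onorm (H x)" by (rule onorm_pos_le[OF lin[OF xin]])
  also have "\<dots> \<le> B" by (rule bound[OF xin])
  finally have B0: "0 \<le> B" .
  interpret taylor_point s \<eta> B x \<phi> g
  proof
    fix z assume "z \<in> cball x \<eta>"
    \<comment> \<open>The mean value inequality on the convex closed ball turns the Hessian bound
      into the Lipschitz constant B = 2 C_x.\<close>
    then show "norm (g z - g x) \<le> B * norm (z - x)"
      by (intro differentiable_bound[OF convex_cball hess bound] xin)
  qed (use s \<eta> bdd borel grad B0 in auto)
  show ?thesis using average_expansion[OF eps] unfolding Let_def B_def by simp
qed

end
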